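(* Let $a,b\in\mathbb{C}$, $0<\lambda<\infty$, $0<\theta<\min\{\pi,\pi/\lambda\}$ and $\mu<1$. Let $f$ be an entire function (of positive, finite order $\lambda$) such that, as $|z|\to\infty$, $$f(z)=\begin{cases} z^a(\log z)^b\exp(z^\lambda)\bigl(1+o(1)\bigr) & \text{for } |\arg z|\le\theta,\\ O\!\left(\exp(\mu|z|^\lambda)\right) & \text{for } |\arg z|>\theta,\end{cases}$$ with each estimate holding uniformly in its sector. Let $r_n=(n/\lambda)^{1/\lambda}$, and suppose that $f$ satisfies the following condition: there exists a constant $\nu$ with $0<\nu<-\operatorname{Re}\varphi(\sigma_1)$ such that, for every compact subset $K$ of $\{z\in\mathbb{C}: z\neq 0,\ |\arg z|\le\theta\}$, $$\frac{f'(r_nz)}{f(r_nz)}=O(e^{\nu n})$$ uniformly for $z\in K$ as $n\to\infty$, where $\varphi$ and $\sigma_1$ are as defined in the context. Let $p_n(z)=\sum_{k=0}^n \frac{f^{(k)}(0)}{k!}z^k$ be the $n$th partial sum of the power series of $f$. Then $$\lim_{n\to\infty}\frac{p_{n-1}\bigl(r_n(1+w/\sqrt n)\bigr)}{f\bigl(r_n(1+w/\sqrt n)\bigr)}=\frac12\operatorname{erfc}\!\left(w\sqrt{\lambda/2}\,\right)$$ uniformly for $w$ in any compact subset of $\{w\in\mathbb{C}:\operatorname{Re}w<0\}$.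
   Context: All powers and logarithms are principal branches, with $\arg z\in(-\pi,\pi]$. Define $\varphi(z)=(z^\lambda-1-\log z^\lambda)/\lambda$, where $\log z^\lambda=\lambda\log z$. One has $\varphi(1)=\varphi'(1)=0$ and $\varphi''(1)=\lambda$, so $z=1$ is a saddle point of $\operatorname{Re}\varphi$. The path (line) of steepest descent of $\operatorname{Re}\varphi$ through $z=1$ is the smooth curve through $1$ on which $\operatorname{Im}\varphi=0$ and along which $\operatorname{Re}\varphi$ decreases as one moves away from $1$; it passes vertically through $1$. Let $\Delta$ be the circle centered at $z=1$ which subtends an angle of $\theta$ from the origin (i.e. the two tangent lines from the origin to $\Delta$ make an angle $\theta$ with each other, so $\Delta$ has radius $\sin(\theta/2)$). Let $\sigma_1,\sigma_2$ be the two points where $\Delta$ intersects the path of steepest descent of $\operatorname{Re}\varphi$ through $z=1$. By symmetry $\sigma_1=\overline{\sigma_2}$ and $\operatorname{Re}\varphi(\sigma_1)=\operatorname{Re}\varphi(\sigma_2)$, and moreover $\operatorname{Re}\varphi(\sigma_1)<0$. The complementary error function is $\operatorname{erfc}(z)=\frac{2}{\sqrt\pi}\int_z^\infty e^{-s^2}\,ds$, with integration along the horizontal line from $s=z$ to the right to $s=z+\infty$. *)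

theory Defs
  imports "HOL-Complex_Analysis.Complex_Analysis" "HOL-Library.Landau_Symbols"
begin

(* The order inf {\<rho> \<ge> 0. |f z| \<le> exp (|z|^\<rho>) for all large |z|} of an entire function;
   it is \<infinity> if there is no such \<rho>. *)
definition entire_order :: "(complex \<Rightarrow> complex) \<Rightarrow> ereal" where
  "entire_order f =
     Inf (ereal ` {\<rho>. 0 \<le> \<rho> \<and> (\<forall>\<^sub>F z in at_infinity. norm (f z) \<le> exp (norm z powr \<rho>))})"

(* log z^\<lambda> is read as \<lambda> log z, which differs from Ln (z powr \<lambda>) when |\<lambda> Arg z| > pi. *)
definition phi :: "real \<Rightarrow> complex \<Rightarrow> complex" where
  "phi lam z =
     (z powr complex_of_real lam - 1 - complex_of_real lam * Ln z) / complex_of_real lam"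

(* \<gamma> is a parametrization, with \<gamma> 0 = 1, of a regular arc through 1 that stays in the domain of
   analyticity of phi (the slit plane), on which Im phi vanishes, and along which Re phi strictly
   decreases as one moves away from 1 in either direction. *)
definition steepest_descent_arc :: "real \<Rightarrow> (real \<Rightarrow> complex) \<Rightarrow> bool" where
  "steepest_descent_arc lam \<gamma> \<longleftrightarrow>
     \<gamma> C1_differentiable_on {-1<..<1} \<and>
     (\<forall>t\<in>{-1<..<1}. vector_derivative \<gamma> (at t) \<noteq> 0) \<and>
     \<gamma> 0 = 1 \<and>
     (\<forall>t\<in>{-1<..<1}. \<gamma> t \<notin> \<real>\<^sub>\<le>\<^sub>0 \<and> Im (phi lam (\<gamma> t)) = 0) \<and>
     (\<forall>s t. 0 \<le> s \<and> s < t \<and> t < 1 \<longrightarrow> Re (phi lam (\<gamma> t)) < Re (phi lam (\<gamma> s))) \<and>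
     (\<forall>s t. -1 < s \<and> s < t \<and> t \<le> 0 \<longrightarrow> Re (phi lam (\<gamma> s)) < Re (phi lam (\<gamma> t)))"

(* The maximal path of steepest descent through 1, as a point set: every arc can be
   reparametrized over (-1,1), so the union is the path continued as far as possible. *)
definition steepest_descent_path :: "real \<Rightarrow> complex set" where
  "steepest_descent_path lam = (\<Union>\<gamma>\<in>Collect (steepest_descent_arc lam). \<gamma> ` {-1<..<1})"

(* The contour runs from z horizontally to the right: s = z + t with t \<ge> 0. *)
definition erfc :: "complex \<Rightarrow> complex" where
  "erfc z = 2 / complex_of_real (sqrt pi) *
     integral {0..} (\<lambda>t. exp (- ((z + complex_of_real t)\<^sup>2)))"

definition taylor_partial_sum :: "(complex \<Rightarrow> complex) \<Rightarrow> nat \<Rightarrow> complex \<Rightarrow> complex" where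
  "taylor_partial_sum f n z = (\<Sum>k\<le>n. (deriv ^^ k) f 0 / fact k * z ^ k)"

definition scale_radius :: "real \<Rightarrow> nat \<Rightarrow> real" where
  "scale_radius lam n = (real n / lam) powr (1 / lam)"

end

theory Submission
  imports Defs "HOL-Probability.Characteristic_Functions" "HOL-Real_Asymp.Real_Asymp"
begin

text \<open>
  Since \<open>Re w < 0\<close>, the point \<open>z = r\<^sub>n (1 + w / \<surd>n)\<close> lies inside the circle of radius \<open>r\<^sub>n\<close> for large
  \<open>n\<close>, so \<open>f z - p\<^sub>n\<^sub>-\<^sub>1 z\<close> is \<open>z\<^sup>n / (2\<pi>\<i>)\<close> times the integral of \<open>f \<zeta> / (\<zeta>\<^sup>n (\<zeta> - z))\<close> over that circle.
  The circle passes through the saddle point and \<open>Re \<phi> (cis t) = (cos (\<lambda>t) - 1) / \<lambda>\<close> has its only maximum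
  on \<open>|t| \<le> \<theta>\<close> at \<open>t = 0\<close>, because \<open>\<lambda>\<theta> < \<pi>\<close>. Hence the circle itself serves as the contour, and it need
  not be deformed to the path of steepest descent. With \<open>t = s / \<surd>(\<lambda>n)\<close> the quotient of the
  integral by \<open>f z\<close> converges by dominated convergence to the Cauchy transform
  of a Gaussian, which is an error function. Uniformity on compact sets follows from convergence along
  all convergent sequences \<open>w\<^sub>k\<close>.
\<close>

subsection \<open>The Cauchy remainder on a circle\<close>

text \<open>Translating the half over \<open>{p..2*p}\<close> back by one period places it on
  \<open>{-p..0}\<close>. This moves the circle parameter to \<open>{-pi..pi}\<close>, where the
  saddle \<open>t = 0\<close> is an interior point and \<open>t\<close> agrees with
  \<open>Arg\<close> except at \<open>- pi\<close>.\<close>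

lemma has_integral_periodic_shift:
  fixes F :: "real \<Rightarrow> 'a::euclidean_space"
  assumes F: "(F has_integral I) {0..2*p}" and p: "0 \<le> p" and per: "\<And>t. F (t + 2*p) = F t"
  shows "(F has_integral I) {-p..p}"
proof -
  have int: "F integrable_on {0..2*p}" using F by blast
  have int1: "F integrable_on {0..p}" and int2: "F integrable_on {p..2*p}"
    by (rule integrable_subinterval_real[OF int]; use p in auto)+
  have "(F has_integral integral {p..2*p} F) (cbox (-p + 2*p) (0 + 2*p))"
    using int2 by (simp add: integrable_integral)
  then have "((F \<circ> ((+) (2*p))) has_integral integral {p..2*p} F) (cbox (-p) 0)"
    by (simp only: has_integral_shift_cbox_iff)
  moreover have "F \<circ> ((+) (2*p)) = F"
    using per by (auto simp: add.commute)
  ultimately have "(F has_integral integral {p..2*p} F) {-p..0}" by simp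
  then have "(F has_integral (integral {p..2*p} F + integral {0..p} F)) {-p..p}"
    using int1 p by (intro has_integral_combine[of "-p" 0 p]) (auto simp: integrable_integral)
  moreover have "integral {0..p} F + integral {p..2*p} F = I"
    using Henstock_Kurzweil_Integration.integral_combine[OF _ _ int, of p] p F by (auto simp: integral_unique)
  ultimately show ?thesis by (simp add: add.commute)
qed

text \<open>Cauchy's formula for \<open>f z\<close> minus the Cauchy formulas for the first
  \<open>n\<close> Taylor coefficients; a geometric sum in \<open>z / u\<close> collapses the
  integrand to \<open>(z / u) ^ n * f u / (u - z)\<close>. The circle is then parametrised with
  \<open>du = \<i> u dt\<close>.\<close>

lemma taylor_remainder_circle:
  fixes f :: "complex \<Rightarrow> complex"
  assumes f: "f holomorphic_on UNIV" and z: "norm z < r" and n: "0 < n"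
  shows "((\<lambda>t. (z / (of_real r * cis t)) ^ n * f (of_real r * cis t) * (of_real r * cis t) / (of_real r * cis t - z))
           has_integral 2 * of_real pi * (f z - taylor_partial_sum f (n - 1) z)) {-pi..pi}"
proof -
  have r: "r > 0" using z norm_ge_zero[of z] by linarith
  have hol: "f holomorphic_on ball 0 r" and cont: "continuous_on (cball 0 r) f"
    using f by (auto intro: holomorphic_on_subset holomorphic_on_imp_continuous_on)
  have 1: "((\<lambda>u. f u / (u - z)) has_contour_integral 2 * of_real pi * \<i> * f z) (circlepath 0 r)"
    by (rule Cauchy_integral_circlepath[OF cont hol]) (use z in simp)
  have 2: "((\<lambda>u. \<Sum>k<n. z ^ k * (f u / (u - 0) ^ Suc k)) has_contour_integral
      (\<Sum>k<n. z ^ k * ((2 * pi * \<i>) / (fact k) * (deriv ^^ k) f 0))) (circlepath 0 r)"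
    by (intro has_contour_integral_sum has_contour_integral_lmul
         Cauchy_has_contour_integral_higher_derivative_circlepath[OF cont hol]) (use r in auto)
  \<comment> \<open>For \<open>n = 0\<close> truncated subtraction would leave the term
    \<open>k = 0\<close> on the left, so positivity of \<open>n\<close> matters.\<close>
  have "{..n - 1} = {..<n}" using n by auto
  then have 3: "(\<Sum>k<n. z ^ k * ((2 * pi * \<i>) / (fact k) * (deriv ^^ k) f 0))
      = 2 * of_real pi * \<i> * taylor_partial_sum f (n - 1) z"
    by (simp add: taylor_partial_sum_def sum_distrib_left mult_ac)
  have 4: "((\<lambda>u. f u / (u - z) - (\<Sum>k<n. z ^ k * (f u / (u - 0) ^ Suc k))) has_contour_integral
     2 * of_real pi * \<i> * (f z - taylor_partial_sum f (n - 1) z)) (circlepath 0 r)"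
    using has_contour_integral_diff[OF 1 2] unfolding 3 by (simp add: algebra_simps)
  let ?G = "\<lambda>u. f u / (u - z) - (\<Sum>k<n. z ^ k * (f u / (u - 0) ^ Suc k))"
  have G: "?G u = (z / u) ^ n * f u / (u - z)" if "norm u = r" for u
  proof -
    have u: "u \<noteq> 0" "u \<noteq> z" using that r z by auto
    have "(\<Sum>k<n. z ^ k * (f u / (u - 0) ^ Suc k)) = f u / u * (\<Sum>k<n. (z / u) ^ k)"
      by (simp add: sum_distrib_left power_divide mult_ac)
    also have "(\<Sum>k<n. (z / u) ^ k) = (1 - (z / u) ^ n) / (1 - z / u)"
      using u sum_gp_strict[of "z/u" n] by simp
    also have "f u / u * ((1 - (z / u) ^ n) / (1 - z / u)) = f u * (1 - (z / u) ^ n) / (u - z)"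
      using u by (simp add: divide_simps)
    finally show ?thesis by (simp add: diff_divide_distrib algebra_simps)
  qed
  have "((\<lambda>t. ?G (0 + of_real r * cis t) * of_real r * \<i> * cis t) has_integral
     2 * of_real pi * \<i> * (f z - taylor_partial_sum f (n - 1) z)) {0..2*pi}"
    using 4 unfolding circlepath_def by (subst (asm) has_contour_integral_part_circlepath_iff) auto
  then have "((\<lambda>t. ?G (of_real r * cis t) * of_real r * \<i> * cis t) has_integral
     2 * of_real pi * \<i> * (f z - taylor_partial_sum f (n - 1) z)) {-pi..pi}"
    by (intro has_integral_periodic_shift) (auto simp: cis.ctr)
  \<comment> \<open>The factor \<open>- \<i>\<close> removes the \<open>\<i>\<close> that comes from
    \<open>du = \<i> u dt\<close>.\<close>
  then have "((\<lambda>t. - \<i> * (?G (of_real r * cis t) * of_real r * \<i> * cis t)) has_integral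
     - \<i> * (2 * of_real pi * \<i> * (f z - taylor_partial_sum f (n - 1) z))) {-pi..pi}"
    by (rule has_integral_mult_right)
  then show ?thesis
  proof (rule has_integral_eq_rhs[OF has_integral_eq, rotated])
    fix t assume "t \<in> {-pi..pi}"
    have "norm (of_real r * cis t) = r" using r by (simp add: norm_mult)
    from G[OF this] show "- \<i> * (?G (of_real r * cis t) * of_real r * \<i> * cis t) =
      (z / (of_real r * cis t)) ^ n * f (of_real r * cis t) * (of_real r * cis t) / (of_real r * cis t - z)"
      by (simp add: algebra_simps)
  qed (simp add: algebra_simps)
qed

subsection \<open>Gaussian integrals and the error function\<close>

text \<open>The modulus is \<open>exp ((Im z)\<^sup>2) * exp (- (Re z + t)\<^sup>2)\<close>, a
  multiple of the normal density with mean \<open>- Re z\<close> and variance 1/2.\<close>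

lemma integrable_gaussian_shift:
  "integrable lborel (\<lambda>t::real. exp (- (z + complex_of_real t)\<^sup>2))"
proof (rule Bochner_Integration.integrable_bound)
  show "integrable lborel (\<lambda>t. exp ((Im z)\<^sup>2) * sqrt pi * normal_density (- Re z) (1 / sqrt 2) t)"
    by (intro integrable_mult_right integrable_normal_density) simp
  show "AE t in lborel. norm (exp (- (z + complex_of_real t)\<^sup>2))
     \<le> norm (exp ((Im z)\<^sup>2) * sqrt pi * normal_density (- Re z) (1 / sqrt 2) t)"
    by (intro AE_I2) (simp add: normal_density_def power_divide Re_power2 power_mult_distrib
          abs_mult real_sqrt_mult flip: exp_add, simp add: algebra_simps)
qed auto

lemma set_integrable_gaussian_shift:
  assumes "A \<in> sets borel"
  shows "set_integrable lborel A (\<lambda>t::real. exp (- (z + complex_of_real t)\<^sup>2))"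
  unfolding set_integrable_def
  by (rule integrable_mult_indicator[OF _ integrable_gaussian_shift]) (use assms in simp)

text \<open>This is the characteristic function of the standard normal distribution, written out
  with its density.\<close>

lemma gaussian_fourier:
  "(LBINT s. exp (\<i> * of_real (t * s) - of_real (s\<^sup>2 / 2))) = sqrt (2 * pi) * exp (- (t\<^sup>2) / 2)"
proof -
  have "complex_of_real (exp (- (t\<^sup>2) / 2)) = (LINT s|std_normal_distribution. iexp (t * s))"
    unfolding char_std_normal_distribution[THEN fun_cong, of t, symmetric] char_def ..
  also have "\<dots> = (LBINT s. std_normal_density s *\<^sub>R iexp (t * s))"
    by (subst integral_density) (auto simp: std_normal_density_def)
  also have "\<dots> = (LBINT s. (1 / sqrt (2 * pi)) *\<^sub>R exp (\<i> * of_real (t * s) - of_real (s\<^sup>2 / 2)))"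
  proof (intro Bochner_Integration.integral_cong refl)
    fix s :: real
    have "exp (\<i> * of_real (t * s) - of_real (s\<^sup>2 / 2)) = iexp (t * s) * of_real (exp (- (s\<^sup>2 / 2)))"
      by (simp only: diff_conv_add_uminus exp_add exp_of_real flip: of_real_minus)
    then show "std_normal_density s *\<^sub>R iexp (t * s)
        = (1 / sqrt (2 * pi)) *\<^sub>R exp (\<i> * of_real (t * s) - of_real (s\<^sup>2 / 2))"
      by (simp add: std_normal_density_def scaleR_conv_of_real)
  qed
  finally show ?thesis by (simp add: scaleR_conv_of_real field_simps)
qed

text \<open>The substitution \<open>t = - Re z + s / sqrt 2\<close> removes \<open>Re z\<close>, and
  \<open>Im z\<close> turns into a frequency, so the Fourier transform of the Gaussian takes the
  place of a contour shift. The factor \<open>exp ((Im z)\<^sup>2)\<close> cancels against the value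
  of that transform.\<close>

lemma integral_gaussian_shift:
  "(LBINT t. exp (- (z + complex_of_real t)\<^sup>2)) = sqrt pi"
proof -
  have "(LBINT t. exp (- (z + complex_of_real t)\<^sup>2))
     = (1 / sqrt 2) *\<^sub>R (LBINT s. exp (- (z + complex_of_real (- Re z + 1 / sqrt 2 * s))\<^sup>2))"
    by (subst lborel_integral_real_affine[where c = "1 / sqrt 2" and t = "- Re z"]) auto
  also have "(LBINT s. exp (- (z + complex_of_real (- Re z + 1 / sqrt 2 * s))\<^sup>2))
     = (LBINT s. exp ((Im z)\<^sup>2) * exp (\<i> * of_real ((- sqrt 2 * Im z) * s) - of_real (s\<^sup>2 / 2)))"
  proof (intro Bochner_Integration.integral_cong refl)
    fix s :: real
    have "- (z + complex_of_real (- Re z + 1 / sqrt 2 * s))\<^sup>2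
      = of_real ((Im z)\<^sup>2) + (\<i> * of_real ((- sqrt 2 * Im z) * s) - of_real (s\<^sup>2 / 2))"
      by (simp add: complex_eq_iff Re_power2 Im_power2 power_divide power_mult_distrib)
        (simp add: field_simps)
    then show "exp (- (z + complex_of_real (- Re z + 1 / sqrt 2 * s))\<^sup>2)
       = exp ((Im z)\<^sup>2) * exp (\<i> * of_real ((- sqrt 2 * Im z) * s) - of_real (s\<^sup>2 / 2))"
      by (simp only: exp_add exp_of_real)
  qed
  also have "\<dots> = exp ((Im z)\<^sup>2) * (sqrt (2 * pi) * exp (- ((- sqrt 2 * Im z)\<^sup>2) / 2))"
    by (simp only: integral_mult_right_zero gaussian_fourier) simp
  also have "\<dots> = sqrt (2 * pi)"
    by (simp add: power_mult_distrib exp_minus)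
  finally show ?thesis by (simp add: real_sqrt_mult scaleR_conv_of_real)
qed

text \<open>Over the whole line the shifted Gaussian has integral \<open>sqrt pi\<close> for every
  \<open>z\<close>. Reflecting \<open>t\<close> turns its left half into the half-line integral that
  defines \<open>erfc (- z)\<close>.\<close>

lemma erfc_reflect: "erfc (- z) = 2 - erfc z"
proof -
  let ?g = "\<lambda>t::real. exp (- (z + complex_of_real t)\<^sup>2)"
  have g: "(?g has_integral sqrt pi) UNIV"
    using has_integral_integral_lborel[OF integrable_gaussian_shift, of z]
    by (simp add: integral_gaussian_shift)
  note set_int = set_integrable_gaussian_shift[of _ z]
  have int: "?g integrable_on {..0}" "?g integrable_on {0..}"
    by (auto intro!: set_borel_integral_eq_integral(1) set_int)
  have "(?g has_integral (integral {..0} ?g + integral {0..} ?g)) ({..0} \<union> {0..})"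
  proof (rule has_integral_Un)
    have "{..0::real} \<inter> {0..} = {0}" by auto
    then show "negligible ({..0::real} \<inter> {0..})" by simp
  qed (use int in \<open>auto simp: integrable_integral\<close>)
  moreover have "{..0::real} \<union> {0..} = UNIV" by auto
  ultimately have eq: "integral {..0} ?g + integral {0..} ?g = sqrt pi"
    using g has_integral_unique by metis
  have "integral {..0} ?g = integral {0..} (\<lambda>t. exp (- (- z + complex_of_real t)\<^sup>2))"
  proof -
    have "(LBINT t:{..0}. ?g t) = (LBINT t:{0..}. ?g (- t))"
      by (subst set_integral_reflect) (simp add: atLeast_def)
    moreover have "set_integrable lborel {0..} (\<lambda>t. ?g (- t))"
      using set_integrable_gaussian_shift[of "{0..}" "- z"]
      by (simp add: power2_eq_square algebra_simps)
    ultimately have "integral {..0} ?g = integral {0..} (\<lambda>t. ?g (- t))"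
      using set_int by (simp add: set_borel_integral_eq_integral(2))
    also have "(\<lambda>t. ?g (- t)) = (\<lambda>t. exp (- (- z + complex_of_real t)\<^sup>2))"
      by (auto simp: power2_eq_square algebra_simps)
    finally show ?thesis .
  qed
  with eq have "integral {0..} (\<lambda>t. exp (- (- z + complex_of_real t)\<^sup>2)) + integral {0..} ?g = sqrt pi"
    by simp
  then have "erfc (- z) + erfc z = 2 / complex_of_real (sqrt pi) * complex_of_real (sqrt pi)"
    unfolding erfc_def by (simp only: flip: distrib_left)
  then show ?thesis by (simp add: algebra_simps)
qed

section \<open>Laplace integrals and the Cauchy transform of the Gaussian\<close>

lemma integrable_exp_decay:
  fixes c :: complex
  assumes "Re c > 0"
  shows "set_integrable lborel {0..} (\<lambda>y. exp (- c * complex_of_real y))"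
proof -
  have "set_integrable lebesgue {0..} (\<lambda>y. exp (- Re c * y))"
    using has_integral_exp_minus_to_infinity[OF assms, of 0]
    by (intro nonnegative_absolutely_integrable_1) auto
  then have "set_integrable lborel {0..} (\<lambda>y. exp (- Re c * y))"
    unfolding set_integrable_def by (subst (asm) integrable_completion) auto
  then show ?thesis
    unfolding set_integrable_def
    by (rule Bochner_Integration.integrable_bound) (auto simp: indicator_def)
qed

lemma integral_exp_decay:
  fixes c :: complex
  assumes "Re c > 0"
  shows "(LBINT y:{0..}. exp (- c * complex_of_real y)) = 1 / c"
proof -
  have c: "c \<noteq> 0" using assms by auto
  have int: "set_integrable lborel {0<..} (\<lambda>y. exp (- c * complex_of_real y))"
    by (rule set_integrable_subset[OF integrable_exp_decay[OF assms]]) auto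
  have "(LBINT y=0..\<infinity>. exp (- c * complex_of_real y)) = 0 - (- 1 / c)"
  proof (rule interval_integral_FTC_integrable[where F = "\<lambda>y. - exp (- c * complex_of_real y) / c"])
    show "((\<lambda>y. - exp (- c * complex_of_real y) / c) has_vector_derivative exp (- c * complex_of_real x)) (at x)" for x
      using c by (auto intro!: derivative_eq_intros has_vector_derivative_real_field simp: field_simps)
    show "set_integrable lborel (einterval 0 \<infinity>) (\<lambda>y. exp (- c * complex_of_real y))"
      using int by (simp add: einterval_def greaterThan_def zero_ereal_def)
    have "((\<lambda>y. - exp (- c * complex_of_real y) / c) \<longlongrightarrow> - 1 / c) (at_right 0)"
      using c by (auto intro!: tendsto_eq_intros)
    then show "(((\<lambda>y. - exp (- c * complex_of_real y) / c) \<circ> real_of_ereal) \<longlongrightarrow> - 1 / c) (at_right 0)"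
      by (simp add: zero_ereal_def ereal_tendsto_simps)
    have "((\<lambda>y. exp (- c * complex_of_real y)) \<longlongrightarrow> 0) at_top"
    proof (rule tendsto_norm_zero_cancel)
      have "((\<lambda>y. exp (- Re c * y)) \<longlongrightarrow> 0) at_top"
        using assms by real_asymp
      then show "((\<lambda>y. norm (exp (- c * complex_of_real y))) \<longlongrightarrow> 0) at_top" by simp
    qed
    then have "((\<lambda>y. - exp (- c * complex_of_real y) / c) \<longlongrightarrow> - 0 / c) at_top"
      by (intro tendsto_intros) (use c in auto)
    then show "(((\<lambda>y. - exp (- c * complex_of_real y) / c) \<circ> real_of_ereal) \<longlongrightarrow> 0) (at_left \<infinity>)"
      by (simp add: ereal_tendsto_simps)
  qed (auto intro!: continuous_intros)
  then have "(LBINT y:{0<..}. exp (- c * complex_of_real y)) = 1 / c"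
    by (simp add: interval_integral_to_infinity_eq zero_ereal_def)
  also have "(LBINT y:{0<..}. exp (- c * complex_of_real y)) = (LBINT y:{0..}. exp (- c * complex_of_real y))"
    unfolding set_lebesgue_integral_def
    by (rule integral_cong_AE) (auto intro!: AE_I[where N = "{0::real}"] simp: indicator_def)
  finally show ?thesis .
qed

text \<open>For \<open>Re v < 0\<close> the factor \<open>1 / (\<i> s - v)\<close> is the Laplace
  integral of \<open>exp (- (\<i> s - v) y)\<close> over \<open>y \<ge> 0\<close>. After the
  integrals are exchanged, the inner one is a Gaussian Fourier transform, and the outer one becomes
  an \<open>erfc\<close> integral by completing the square.\<close>

lemma gaussian_cauchy_transform:
  fixes v :: complex
  assumes v: "Re v < 0"
  shows "((\<lambda>s. exp (- (of_real (s\<^sup>2) / 2) - v\<^sup>2 / 2) / (\<i> * of_real s - v))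
     has_integral of_real pi * erfc (- v / of_real (sqrt 2))) UNIV"
proof -
  define F where "F = (\<lambda>(x::real) (y::real). of_real (exp (- x\<^sup>2 / 2)) *
     (indicator {0..} y *\<^sub>R exp (- (\<i> * of_real x - v) * of_real y)))"
  have [measurable]: "(\<lambda>(x, y). F x y) \<in> borel_measurable (lborel \<Otimes>\<^sub>M lborel)"
    unfolding F_def by measurable
  have decay: "set_integrable lborel {0..} (\<lambda>y. exp (- (\<i> * of_real x - v) * of_real y))" for x
    by (rule integrable_exp_decay) (use v in simp)
  have gauss: "integrable lborel (\<lambda>x::real. exp (- x\<^sup>2 / 2))"
    using integrable_mult_right[OF integrable_normal_density[of 1 0], of "sqrt (2 * pi)"]
    by (simp add: std_normal_density_def)
  \<comment> \<open>The modulus of \<open>F\<close> splits into a factor in \<open>x\<close> and a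
    factor in \<open>y\<close>, so the Tonelli condition reduces to integrals in one
    variable.\<close>
  have Fint: "integrable (lborel \<Otimes>\<^sub>M lborel) (\<lambda>(x, y). F x y)"
  proof (rule lborel_pair.Fubini_integrable)
    have "norm (F x y) = exp (- x\<^sup>2 / 2) * (indicator {0..} y * exp (Re v * y))" for x y
      by (simp add: F_def norm_mult indicator_def)
    then have "(\<lambda>x. LBINT y. norm (F x y)) = (\<lambda>x. exp (- x\<^sup>2 / 2) * (LBINT y. indicator {0..} y * exp (Re v * y)))"
      by simp
    with gauss show "integrable lborel (\<lambda>x. LBINT y. norm (case (x, y) of (x, y) \<Rightarrow> F x y))"
      by simp
    show "AE x in lborel. integrable lborel (\<lambda>y. case (x, y) of (x, y) \<Rightarrow> F x y)"
      unfolding F_def prod.case by (intro AE_I2 integrable_mult_right decay[unfolded set_integrable_def])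
  qed measurable
  have inner_y: "(LBINT y. F x y) = exp (- (of_real (x\<^sup>2) / 2)) / (\<i> * of_real x - v)" for x
  proof -
    have "(LBINT y. F x y) = of_real (exp (- x\<^sup>2 / 2)) * (1 / (\<i> * of_real x - v))"
      using integral_exp_decay[of "\<i> * of_real x - v"] v
      unfolding F_def set_lebesgue_integral_def by (subst integral_mult_right_zero) simp
    then show ?thesis by (simp flip: exp_of_real)
  qed
  have inner_x: "(LBINT x. F x y) = sqrt (2 * pi) * (indicator {0..} y *\<^sub>R exp (v * of_real y - of_real (y\<^sup>2 / 2)))" for y
  proof -
    have "F x y = indicator {0..} y * exp (v * of_real y) * exp (\<i> * of_real (- y * x) - of_real (x\<^sup>2 / 2))" for x
    proof -
      have "of_real (exp (- x\<^sup>2 / 2)) * exp (- (\<i> * of_real x - v) * of_real y)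
        = exp (- (of_real (x\<^sup>2 / 2)) + - (\<i> * of_real x - v) * of_real y)"
        by (simp only: exp_add) (simp flip: exp_of_real)
      also have "\<dots> = exp (v * of_real y + (\<i> * of_real (- y * x) - of_real (x\<^sup>2 / 2)))"
        by (rule arg_cong[of _ _ exp]) (simp add: algebra_simps)
      finally show ?thesis by (simp add: F_def exp_add indicator_def)
    qed
    then have "(LBINT x. F x y) = indicator {0..} y * exp (v * of_real y) * (sqrt (2 * pi) * exp (- ((- y)\<^sup>2) / 2))"
      by (simp only: integral_mult_right_zero gaussian_fourier)
    moreover have "exp (v * of_real y - of_real (y\<^sup>2 / 2)) = exp (v * of_real y) * of_real (exp (- ((- y)\<^sup>2) / 2))"
      by (simp only: diff_conv_add_uminus exp_add) (simp flip: exp_of_real)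
    ultimately show ?thesis
      by (simp add: indicator_def)
  qed
  have "integrable lborel (\<lambda>x. LBINT y. F x y)"
    using lborel_pair.integrable_fst'[OF Fint] by simp
  then have int: "integrable lborel (\<lambda>x. exp (- (of_real (x\<^sup>2) / 2)) / (\<i> * of_real x - v))"
    by (simp add: inner_y)
  have "(LBINT x. exp (- (of_real (x\<^sup>2) / 2)) / (\<i> * of_real x - v)) = (LBINT y. LBINT x. F x y)"
    using lborel_pair.Fubini_integral[OF Fint] by (simp add: inner_y)
  also have "\<dots> = sqrt (2 * pi) * (LBINT y. indicator {0..} y *\<^sub>R exp (v * of_real y - of_real (y\<^sup>2 / 2)))"
    by (simp only: inner_x integral_mult_right_zero)
  \<comment> \<open>The scaling \<open>y = sqrt 2 * t\<close> turns
    \<open>exp (- y\<^sup>2 / 2)\<close> into \<open>exp (- t\<^sup>2)\<close>, the normalisation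
    used by \<open>erfc\<close>.\<close>
  also have "(LBINT y. indicator {0..} y *\<^sub>R exp (v * of_real y - of_real (y\<^sup>2 / 2)))
    = sqrt 2 * (LBINT t. indicator {0..} (sqrt 2 * t) *\<^sub>R exp (v * of_real (sqrt 2 * t) - of_real ((sqrt 2 * t)\<^sup>2 / 2)))"
    by (subst lborel_integral_real_affine[where c = "sqrt 2" and t = 0]) (auto simp: scaleR_conv_of_real)
  also have "(LBINT t. indicator {0..} (sqrt 2 * t) *\<^sub>R exp (v * of_real (sqrt 2 * t) - of_real ((sqrt 2 * t)\<^sup>2 / 2)))
    = (LBINT t. exp (v\<^sup>2 / 2) * (indicator {0..} t *\<^sub>R exp (- (- v / of_real (sqrt 2) + of_real t)\<^sup>2)))"
  proof (intro Bochner_Integration.integral_cong refl)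
    fix t :: real
    have "v * of_real (sqrt 2 * t) - of_real ((sqrt 2 * t)\<^sup>2 / 2) = v\<^sup>2 / 2 + - (- v / of_real (sqrt 2) + of_real t)\<^sup>2"
    proof -
      \<comment> \<open>With \<open>v = u * q\<close> the square root enters only through
        \<open>q\<^sup>2 = 2\<close>, and completing the square becomes polynomial algebra.\<close>
      define q where "q = complex_of_real (sqrt 2)"
      have q2: "q\<^sup>2 = 2" unfolding q_def by (simp flip: of_real_power)
      then have q0: "q \<noteq> 0" by auto
      define u where "u = v / q"
      have v: "v = u * q" using q0 by (simp add: u_def)
      have "v * (q * t) - (q * t)\<^sup>2 / 2 = q\<^sup>2 * (u * t) - q\<^sup>2 * t\<^sup>2 / 2"
        unfolding v by (simp add: power2_eq_square algebra_simps)
      also have "\<dots> = q\<^sup>2 * u\<^sup>2 / 2 - (- u + of_real t)\<^sup>2"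
        unfolding q2 by (simp add: power2_eq_square algebra_simps)
      finally show ?thesis
        unfolding u_def q_def[symmetric] using q0 by (simp add: power_divide q_def)
    qed
    then show "indicator {0..} (sqrt 2 * t) *\<^sub>R exp (v * of_real (sqrt 2 * t) - of_real ((sqrt 2 * t)\<^sup>2 / 2))
      = exp (v\<^sup>2 / 2) * (indicator {0..} t *\<^sub>R exp (- (- v / of_real (sqrt 2) + of_real t)\<^sup>2))"
      by (simp only: exp_add) (simp add: indicator_def zero_le_mult_iff)
  qed
  also have "\<dots> = exp (v\<^sup>2 / 2) * (LBINT t:{0..}. exp (- (- v / of_real (sqrt 2) + of_real t)\<^sup>2))"
    unfolding set_lebesgue_integral_def by (rule integral_mult_right_zero)
  also have "(LBINT t:{0..}. exp (- (- v / of_real (sqrt 2) + of_real t)\<^sup>2)) =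
      integral {0..} (\<lambda>t. exp (- (- v / of_real (sqrt 2) + of_real t)\<^sup>2))"
    by (intro set_borel_integral_eq_integral(2) set_integrable_gaussian_shift) simp
  also have "\<dots> = of_real (sqrt pi) / 2 * erfc (- v / of_real (sqrt 2))"
    by (simp add: erfc_def)
  also have "complex_of_real (sqrt (2 * pi)) * (sqrt 2 * (exp (v\<^sup>2 / 2) * (of_real (sqrt pi) / 2 * erfc (- v / of_real (sqrt 2)))))
    = of_real (sqrt (2 * pi) * sqrt 2 * sqrt pi / 2) * exp (v\<^sup>2 / 2) * erfc (- v / of_real (sqrt 2))"
    by simp
  also have "sqrt (2 * pi) * sqrt 2 * sqrt pi / 2 = pi"
  proof -
    have "sqrt (2 * pi) * sqrt 2 * sqrt pi / 2 = sqrt (2 * pi) * sqrt (2 * pi) / 2"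
      by (simp only: real_sqrt_mult mult.assoc)
    then show ?thesis by simp
  qed
  finally have val: "(LBINT x. exp (- (of_real (x\<^sup>2) / 2)) / (\<i> * of_real x - v))
    = of_real pi * exp (v\<^sup>2 / 2) * erfc (- v / of_real (sqrt 2))" .
  have "exp (- (of_real (s\<^sup>2) / 2) - v\<^sup>2 / 2) = exp (- (v\<^sup>2 / 2)) * exp (- (of_real (s\<^sup>2) / 2))" for s :: real
    by (simp only: diff_conv_add_uminus exp_add mult.commute)
  moreover have "exp (- (v\<^sup>2 / 2)) * (of_real pi * exp (v\<^sup>2 / 2) * erfc (- v / of_real (sqrt 2)))
    = of_real pi * erfc (- v / of_real (sqrt 2))"
    by (simp add: exp_minus)
  ultimately show ?thesis
    using has_integral_mult_right[OF has_integral_integral_lborel[OF int], of "exp (- (v\<^sup>2 / 2))"]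
    unfolding val by (simp only: times_divide_eq_right)
qed

text \<open>Functions of this form will dominate the rescaled remainder integrands.\<close>

lemma integrable_on_gaussian:
  assumes "0 < \<kappa>" shows "(\<lambda>s::real. exp (- \<kappa> * s\<^sup>2)) integrable_on UNIV"
proof -
  have "integrable lborel (\<lambda>t::real. norm (exp (- (0 + complex_of_real (0 + sqrt \<kappa> * t))\<^sup>2)))"
    by (intro integrable_norm lborel_integrable_real_affine[OF integrable_gaussian_shift]) (use assms in simp)
  also have "(\<lambda>t::real. norm (exp (- (0 + complex_of_real (0 + sqrt \<kappa> * t))\<^sup>2))) = (\<lambda>t. exp (- \<kappa> * t\<^sup>2))"
    using assms by (simp add: power_mult_distrib flip: of_real_power)
  finally show ?thesis using has_integral_integral_lborel by blast
qed

subsection \<open>The exponent at the saddle point\<close>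

definition growth :: "complex \<Rightarrow> complex \<Rightarrow> real \<Rightarrow> complex \<Rightarrow> complex" where
  "growth a b lam z = z powr a * Ln z powr b * exp (z powr complex_of_real lam)"

text \<open>
  This is \<open>n \<phi> (e\<^sup>x)\<close> plus the contribution of the factors \<open>z\<^sup>a\<close> and \<open>(log z)\<^sup>b\<close> at \<open>z = r\<^sub>n e\<^sup>x\<close>, normalised
  to vanish at \<open>x = 0\<close>.
\<close>
definition saddle_exponent :: "complex \<Rightarrow> complex \<Rightarrow> real \<Rightarrow> nat \<Rightarrow> complex \<Rightarrow> complex" where
  "saddle_exponent a b lam n x =
     a * x + b * Ln (1 + x / of_real (ln (scale_radius lam n))) +
     of_nat n * ((exp (of_real lam * x) - 1) / of_real lam - x)"

text \<open>For a radius above 1 this is the value of \<open>growth\<close> at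
  \<open>scale_radius lam n\<close>, because that radius has \<open>lam\<close>-th power
  \<open>n / lam\<close>. As an exponential it is visibly nonzero for every
  \<open>n\<close>.\<close>

definition saddle_constant :: "complex \<Rightarrow> complex \<Rightarrow> real \<Rightarrow> nat \<Rightarrow> complex" where
  "saddle_constant a b lam n =
     exp (a * of_real (ln (scale_radius lam n)) + b * of_real (ln (ln (scale_radius lam n))) +
          of_nat n / of_real lam)"

text \<open>Since \<open>0 powr _ = 0\<close>, the only zeros are at \<open>z = 0\<close> and where
  \<open>Ln z = 0\<close>, that is at \<open>z = 1\<close>; both are excluded by the norm.\<close>

lemma growth_nonzero:
  assumes "1 < norm z"
  shows "growth a b lam z \<noteq> 0"
proof -
  have z: "z \<noteq> 0" "z \<noteq> 1" using assms by auto
  then have "Ln z \<noteq> 0" using exp_Ln[of z] by (metis exp_zero)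
  with z show ?thesis by (simp add: growth_def)
qed

text \<open>On the strip \<open>- pi < Im x \<le> pi\<close> the principal logarithm of
  \<open>r e^x\<close> is exactly \<open>ln r + x\<close>, and its own logarithm splits off
  \<open>ln (ln r)\<close>. The factor \<open>exp (n x)\<close> is separated because it cancels the
  power \<open>\<zeta>^n\<close> in the Cauchy remainder; what is left in the exponent has no term
  of order \<open>n x\<close>.\<close>

lemma growth_exp:
  assumes lam: "0 < lam" and n: "0 < n" and r: "1 < scale_radius lam n"
    and x: "- pi < Im x" "Im x \<le> pi" "of_real (ln (scale_radius lam n)) + x \<noteq> 0"
  shows "growth a b lam (of_real (scale_radius lam n) * exp x) =
     saddle_constant a b lam n * exp (of_nat n * x) * exp (saddle_exponent a b lam n x)"
proof -
  define r where "r = scale_radius lam n"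
  define L where "L = ln r"
  have r0: "0 < r" and L0: "0 < L" using r by (auto simp: r_def L_def)
  have Ln_r: "Ln (of_real r * exp x) = of_real L + x"
    using r0 x by (simp add: Ln_times_of_real Ln_of_real L_def)
  have "Ln (of_real L + x) = Ln (of_real L * (1 + x / of_real L))"
    using L0 by (simp add: algebra_simps)
  also have "\<dots> = of_real (ln L) + Ln (1 + x / of_real L)"
  proof -
    have "1 + x / of_real L \<noteq> 0"
      using x(3) L0 by (auto simp: L_def r_def add_divide_eq_iff)
    from Ln_times_of_real[OF L0 this] show ?thesis
      using L0 by (simp add: Ln_of_real)
  qed
  finally have Ln_L: "Ln (of_real L + x) = of_real (ln L) + Ln (1 + x / of_real L)" .
  have "exp (lam * L) = real n / lam"
    using lam n by (simp add: L_def r_def scale_radius_def ln_powr)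
  then have "exp (complex_of_real lam * of_real L) = of_nat n / of_real lam"
    by (metis exp_of_real of_real_divide of_real_mult of_real_of_nat_eq)
  then have pw: "(of_real r * exp x) powr of_real lam = of_nat n / of_real lam * exp (of_real lam * x)"
    using r0 by (simp add: powr_def Ln_r distrib_left exp_add)
  have "growth a b lam (of_real r * exp x) =
     exp (a * (of_real L + x) + b * (of_real (ln L) + Ln (1 + x / of_real L))
       + of_nat n / of_real lam * exp (of_real lam * x))"
    unfolding growth_def pw unfolding powr_def Ln_r Ln_L
    using r0 x(3) by (simp add: exp_add L_def r_def)
  also have "a * (of_real L + x) + b * (of_real (ln L) + Ln (1 + x / of_real L))
       + of_nat n / of_real lam * exp (of_real lam * x)
     = (a * of_real L + b * of_real (ln L) + of_nat n / of_real lam) + of_nat n * x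
        + saddle_exponent a b lam n x"
    using lam by (simp add: saddle_exponent_def L_def r_def field_simps)
  finally show ?thesis
    unfolding exp_add saddle_constant_def by (simp add: L_def r_def exp_add)
qed

section \<open>Limits at the saddle under the scaling by \<open>sqrt n\<close>\<close>

lemma filterlim_scale_radius:
  assumes "0 < lam" shows "filterlim (scale_radius lam) at_top sequentially"
  unfolding scale_radius_def using assms by real_asymp

lemma filterlim_ln_scale_radius:
  assumes "0 < lam" shows "filterlim (\<lambda>n. ln (scale_radius lam n)) at_top sequentially"
  using filterlim_compose[OF ln_at_top filterlim_scale_radius[OF assms]] .

text \<open>Caratheodory's form \<open>F z = g z * z\<close> with \<open>g\<close> continuous at 0
  allows unbounded scale factors \<open>c k\<close>: they attach to \<open>x k\<close>, where
  convergence is assumed.\<close>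

lemma scaled_tendsto_derivative:
  fixes F :: "complex \<Rightarrow> complex"
  assumes F: "(F has_field_derivative D) (at 0)" "F 0 = 0"
    and x: "x \<longlonglongrightarrow> 0" "(\<lambda>k. c k * x k) \<longlonglongrightarrow> y"
  shows "(\<lambda>k. c k * F (x k)) \<longlonglongrightarrow> D * y"
proof -
  obtain g where g: "\<And>z. F z = g z * z" "isCont g 0" "g 0 = D"
    using F by (auto simp: CARAT_DERIV)
  have "(\<lambda>k. g (x k) * (c k * x k)) \<longlonglongrightarrow> D * y"
    using isCont_tendsto_compose[OF g(2) x(1)] g(3) x(2) by (intro tendsto_mult) auto
  then show ?thesis by (simp add: g(1) mult_ac)
qed

text \<open>The quotient is \<open>\<phi> (e^z) / z\<^sup>2\<close>. The Taylor polynomial of degree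
  2 of the exponential gives the limit, and the cubic remainder still has a factor
  \<open>norm z\<close> after division.\<close>

lemma exp_quotient2_tendsto:
  fixes lam :: complex
  assumes "lam \<noteq> 0"
  shows "((\<lambda>z. ((exp (lam * z) - 1) / lam - z) / z\<^sup>2) \<longlongrightarrow> lam / 2) (at 0)"
proof (rule LIM_zero_cancel, rule Lim_null_comparison)
  show "\<forall>\<^sub>F z in at 0. norm (((exp (lam * z) - 1) / lam - z) / z\<^sup>2 - lam / 2)
      \<le> exp (norm (lam * z)) * (norm lam)\<^sup>2 * norm z / 2"
  proof (rule eventually_at_filter[THEN iffD2], intro always_eventually allI impI)
    fix z :: complex assume z: "z \<noteq> 0"
    have "norm (exp (lam * z) - (\<Sum>i\<le>2. (lam * z) ^ i / fact i)) \<le> exp (norm (lam * z)) * norm (lam * z) ^ 3 / 2"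
      using Taylor_exp_field[of "lam * z" 2] by (simp add: eval_nat_numeral)
    moreover have "((exp (lam * z) - 1) / lam - z) / z\<^sup>2 - lam / 2
        = (exp (lam * z) - (\<Sum>i\<le>2. (lam * z) ^ i / fact i)) / (lam * z\<^sup>2)"
      using z assms by (simp add: eval_nat_numeral field_simps)
    ultimately have "norm (((exp (lam * z) - 1) / lam - z) / z\<^sup>2 - lam / 2)
       \<le> exp (norm (lam * z)) * norm (lam * z) ^ 3 / 2 / norm (lam * z\<^sup>2)"
      by (simp only: norm_divide divide_right_mono norm_ge_zero)
    also have "\<dots> = exp (norm (lam * z)) * (norm lam)\<^sup>2 * norm z / 2"
      using z assms by (simp add: norm_mult norm_power power2_eq_square power3_eq_cube)
    finally show "norm (((exp (lam * z) - 1) / lam - z) / z\<^sup>2 - lam / 2) \<le> \<dots>" .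
  qed
  show "((\<lambda>z. exp (norm (lam * z)) * (norm lam)\<^sup>2 * norm z / 2) \<longlongrightarrow> 0) (at 0)"
    by (auto intro!: tendsto_eq_intros)
qed

text \<open>At distance of order \<open>1 / sqrt N\<close> from the saddle the contributions of
  \<open>a\<close> and \<open>b\<close> vanish, and \<open>N\<close> times the quadratic term of
  \<open>\<phi>\<close> has a finite limit. The index \<open>N k\<close> is an arbitrary sequence
  tending to infinity because uniformity is later tested along sequences.\<close>

lemma saddle_exponent_tendsto:
  fixes N :: "nat \<Rightarrow> nat" and x :: "nat \<Rightarrow> complex"
  assumes lam: "0 < lam" and N: "filterlim N at_top sequentially"
    and x: "(\<lambda>k. of_real (sqrt (N k)) * x k) \<longlonglongrightarrow> y"
  shows "(\<lambda>k. saddle_exponent a b lam (N k) (x k)) \<longlonglongrightarrow> of_real lam * y\<^sup>2 / 2"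
proof -
  have rootN: "filterlim (\<lambda>k. sqrt (N k)) at_top sequentially"
    by (rule filterlim_compose[OF sqrt_at_top filterlim_compose[OF filterlim_real_sequentially N]])
  have Npos: "\<forall>\<^sub>F k in sequentially. N k > 0"
    using eventually_compose_filterlim[OF eventually_gt_at_top N] .
  have x0: "x \<longlonglongrightarrow> 0"
  proof -
    have "(\<lambda>k. of_real (inverse (sqrt (N k))) * (of_real (sqrt (N k)) * x k)) \<longlonglongrightarrow> of_real 0 * y"
      by (intro tendsto_mult tendsto_of_real x tendsto_inverse_0_at_top rootN)
    moreover have "\<forall>\<^sub>F k in sequentially. of_real (inverse (sqrt (N k))) * (of_real (sqrt (N k)) * x k) = x k"
      using Npos by eventually_elim (simp flip: mult.assoc of_real_mult)
    ultimately have "x \<longlonglongrightarrow> of_real 0 * y" by (rule Lim_transform_eventually)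
    then show ?thesis by simp
  qed
  have "(\<lambda>k. b * Ln (1 + x k / of_real (ln (scale_radius lam (N k))))) \<longlonglongrightarrow> b * Ln (1 + 0)"
  proof (intro tendsto_intros)
    have "(\<lambda>k. x k * of_real (inverse (ln (scale_radius lam (N k))))) \<longlonglongrightarrow> 0 * of_real 0"
      by (intro tendsto_mult tendsto_of_real x0
          tendsto_inverse_0_at_top filterlim_compose[OF filterlim_ln_scale_radius[OF lam] N])
    then show "(\<lambda>k. x k / of_real (ln (scale_radius lam (N k)))) \<longlonglongrightarrow> 0"
      by (simp add: divide_inverse)
  qed auto
  moreover have "(\<lambda>k. of_nat (N k) * ((exp (of_real lam * x k) - 1) / of_real lam - x k)) \<longlonglongrightarrow> of_real lam * y\<^sup>2 / 2"
  proof -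
    \<comment> \<open>\<open>h\<close> fills the removable singularity at 0, so that indices with
      \<open>x k = 0\<close> need no separate treatment.\<close>
    define h where "h = (\<lambda>z::complex. if z = 0 then of_real lam / 2 else ((exp (of_real lam * z) - 1) / of_real lam - z) / z\<^sup>2)"
    have "((\<lambda>z. ((exp (of_real lam * z) - 1) / of_real lam - z) / z\<^sup>2) \<longlongrightarrow> complex_of_real lam / 2) (at 0)"
      using exp_quotient2_tendsto[of "of_real lam"] lam by simp
    then have "(h \<longlongrightarrow> of_real lam / 2) (at 0)"
      by (rule Lim_transform_eventually) (auto simp: h_def eventually_at_filter)
    then have "isCont h 0" by (simp add: isCont_def h_def)
    from isCont_tendsto_compose[OF this x0]
    have "(\<lambda>k. h (x k)) \<longlonglongrightarrow> of_real lam / 2" by (simp add: h_def[THEN fun_cong, of 0])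
    then have "(\<lambda>k. (of_real (sqrt (N k)) * x k)\<^sup>2 * h (x k)) \<longlonglongrightarrow> y\<^sup>2 * (of_real lam / 2)"
      by (intro tendsto_intros x)
    moreover have "(of_real (sqrt (N k)) * x k)\<^sup>2 * h (x k)
      = of_nat (N k) * ((exp (of_real lam * x k) - 1) / of_real lam - x k)" for k
      by (auto simp: h_def power_mult_distrib simp flip: of_real_power)
    ultimately show ?thesis by (simp add: mult_ac)
  qed
  ultimately have "(\<lambda>k. saddle_exponent a b lam (N k) (x k)) \<longlonglongrightarrow> a * 0 + b * Ln (1 + 0) + of_real lam * y\<^sup>2 / 2"
    unfolding saddle_exponent_def by (intro tendsto_add tendsto_mult[OF tendsto_const[of a] x0])
  then show ?thesis by simp
qed

section \<open>Bounds away from the saddle\<close>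

lemma one_minus_cos_ge:
  assumes "\<bar>x\<bar> \<le> pi"
  shows "2 * x\<^sup>2 / pi\<^sup>2 \<le> 1 - cos x"
proof -
  define y where "y = \<bar>x\<bar> / 2"
  have y: "0 \<le> y" "y \<le> pi / 2" using assms by (auto simp: y_def)
  \<comment> \<open>Jordan's inequality: the concave sine lies above its chord from 0 to
    \<open>pi / 2\<close>. Squared, it bounds \<open>1 - cos x\<close> by the half-angle
    formula.\<close>
  have "concave_on {0..pi} sin"
    by (rule f''_le0_imp_concave[where f' = cos and f'' = "\<lambda>x. - sin x"])
       (auto intro!: derivative_eq_intros sin_ge_zero)
  from concave_onD[OF this, of "2 * y / pi" 0 "pi / 2"]
  have "2 * y / pi \<le> sin y" using y by (simp add: field_simps)
  then have "(2 * y / pi)\<^sup>2 \<le> (sin y)\<^sup>2" using y by (intro power_mono) auto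
  moreover have "1 - cos x = 2 * (sin y)\<^sup>2"
    using cos_double_sin[of y] by (simp add: y_def)
  moreover have "2 * x\<^sup>2 / pi\<^sup>2 = 2 * (2 * y / pi)\<^sup>2" by (simp add: y_def power_divide)
  ultimately show ?thesis by simp
qed

text \<open>On the circle the main term is \<open>n (cos (lam t) - 1) / lam\<close>. Since
  \<open>lam * \<theta> \<le> pi\<close>, the quadratic cosine bound is available for every
  \<open>t\<close> in the sector, while the terms with \<open>a\<close> and \<open>b\<close> stay
  bounded.\<close>

lemma saddle_exponent_imaginary_bound:
  assumes lam: "0 < lam" and theta: "\<theta> \<le> pi" "lam * \<theta> \<le> pi"
  shows "\<forall>\<^sub>F n in sequentially. \<forall>t. \<bar>t\<bar> \<le> \<theta> \<longrightarrow>
     Re (saddle_exponent a b lam n (\<i> * of_real t)) \<le> norm a * pi + norm b - 2 * lam / pi\<^sup>2 * (real n * t\<^sup>2)"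
proof -
  \<comment> \<open>With \<open>L > 2 * pi\<close> and \<open>\<bar>t\<bar> \<le> pi\<close> one has
    \<open>norm (\<i> t / L) < 1 / 2\<close>, so the estimate
    \<open>norm (Ln (1 + q)) \<le> 2 * norm q\<close> bounds the logarithm by 1.\<close>
  have "\<forall>\<^sub>F n in sequentially. ln (scale_radius lam n) > 2 * pi"
    using filterlim_ln_scale_radius[OF lam] by (simp add: filterlim_at_top_dense)
  then show ?thesis
  proof eventually_elim
    case (elim n)
    define L where "L = ln (scale_radius lam n)"
    have L: "L > 2 * pi" using elim by (simp add: L_def)
    show ?case
    proof (intro allI impI)
      fix t :: real assume t: "\<bar>t\<bar> \<le> \<theta>"
      have 1: "Re (a * (\<i> * of_real t)) \<le> norm a * pi"
      proof -
        have "Re (a * (\<i> * of_real t)) \<le> norm (a * (\<i> * of_real t))" by (rule complex_Re_le_cmod)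
        also have "\<dots> \<le> norm a * pi" using t theta by (auto simp: norm_mult intro!: mult_left_mono)
        finally show ?thesis .
      qed
      have 2: "Re (b * Ln (1 + \<i> * of_real t / of_real L)) \<le> norm b"
      proof -
        have q: "norm (\<i> * of_real t / of_real L) < 1 / 2"
          using t theta L pi_gt_zero by (simp add: norm_mult norm_divide field_simps)
        have "Re (b * Ln (1 + \<i> * of_real t / of_real L)) \<le> norm b * norm (Ln (1 + \<i> * of_real t / of_real L))"
          using complex_Re_le_cmod by (metis norm_mult)
        also have "\<dots> \<le> norm b * 1"
          using norm_Ln_le[OF q] q by (intro mult_left_mono) auto
        finally show ?thesis by simp
      qed
      have "\<bar>lam * t\<bar> \<le> pi"
        using order.trans[OF mult_left_mono[OF t, of lam] theta(2)] lam by (simp add: abs_mult)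
      from one_minus_cos_ge[OF this]
      have "(cos (lam * t) - 1) / lam \<le> - (2 * lam / pi\<^sup>2 * t\<^sup>2)"
        using lam by (simp add: field_simps power2_eq_square)
      from mult_left_mono[OF this, of "real n"]
      have 3: "Re (of_nat n * ((exp (of_real lam * (\<i> * of_real t)) - 1) / of_real lam - \<i> * of_real t))
          \<le> - (2 * lam / pi\<^sup>2 * (real n * t\<^sup>2))"
        using lam by (simp add: Re_exp mult_ac)
      show "Re (saddle_exponent a b lam n (\<i> * of_real t)) \<le> norm a * pi + norm b - 2 * lam / pi\<^sup>2 * (real n * t\<^sup>2)"
        using 1 2 3 unfolding saddle_exponent_def L_def plus_complex.sel by linarith
    qed
  qed
qed

text \<open>The logarithm of \<open>norm (saddle_constant a b lam n)\<close> is
  \<open>n / lam\<close> up to terms of order \<open>ln n\<close>. Of the gap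
  \<open>(1 - \<mu>) n / lam\<close> between the two exponents one half absorbs those terms and the
  other half is the decay rate obtained.\<close>

lemma saddle_constant_dominates:
  assumes lam: "0 < lam" and mu: "\<mu> < 1"
  shows "\<forall>\<^sub>F n in sequentially. exp (\<mu> * (real n / lam)) / norm (saddle_constant a b lam n)
      \<le> exp (- ((1 - \<mu>) / (2 * lam)) * real n)"
proof -
  define A B where "A = Re a" and "B = Re b"
  define d where "d = (1 - \<mu>) / (2 * lam)"
  have d: "d > 0" using assms by (simp add: d_def)
  have "filterlim (\<lambda>n::nat. A * ln ((real n / lam) powr (1 / lam)) + B * ln (ln ((real n / lam) powr (1 / lam))) + d * real n) at_top sequentially"
    using d lam by real_asymp
  then have "\<forall>\<^sub>F n::nat in sequentially. A * ln ((real n / lam) powr (1 / lam)) + B * ln (ln ((real n / lam) powr (1 / lam))) + d * real n > 0"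
    by (simp add: filterlim_at_top_dense)
  then show ?thesis
  proof eventually_elim
    case (elim n)
    have "\<mu> * (real n / lam) + 2 * d * real n = real n / lam"
      using lam by (simp add: d_def field_simps)
    with elim have "\<mu> * (real n / lam) - (A * ln (scale_radius lam n) + B * ln (ln (scale_radius lam n)) + real n / lam) \<le> - d * real n"
      by (simp add: scale_radius_def)
    then show ?case
      by (simp add: saddle_constant_def A_def B_def d_def flip: exp_diff)
  qed
qed

subsection \<open>Dominated convergence of the remainder\<close>

lemma Arg_of_real_cis:
  assumes "0 < r" "- pi < t" "t \<le> pi"
  shows "Arg (of_real r * cis t) = t"
  using assms by (simp add: Arg_cis)

text \<open>The absolute values of \<open>Arg\<close> and of \<open>t\<close> agree on the circle;
  only \<open>t = - pi\<close> needs care, since \<open>Arg\<close> takes the value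
  \<open>pi\<close> there.\<close>

lemma circle_in_outer_sector:
  assumes "0 < r" "\<bar>t\<bar> \<le> pi" "\<theta> < \<bar>t\<bar>"
  shows "\<theta> < \<bar>Arg (of_real r * cis t)\<bar>"
proof (cases "t = - pi")
  case True
  then have "of_real r * cis t = of_real r * cis pi" by (simp add: complex_eq_iff)
  then show ?thesis using assms True Arg_of_real_cis[of r pi] by simp
next
  case False
  then show ?thesis using assms Arg_of_real_cis[of r t] by auto
qed

section \<open>The sector hypotheses and the rescaled Cauchy remainder\<close>

locale sector_asymptotics =
  fixes a b :: complex and lam \<theta> \<mu> :: real and f :: "complex \<Rightarrow> complex"
  assumes lam: "0 < lam"
    and theta: "0 < \<theta>" "\<theta> < min pi (pi / lam)"
    and mu: "\<mu> < 1"
    and entire: "f holomorphic_on UNIV"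
    and inside_sector: "f \<sim>[inf at_infinity (principal {z. \<bar>Arg z\<bar> \<le> \<theta>})] growth a b lam"
    and outside_sector:
      "(\<lambda>z. norm (f z)) \<in> O[inf at_infinity (principal {z. \<bar>Arg z\<bar> > \<theta>})](\<lambda>z. exp (\<mu> * norm z powr lam))"
begin

definition rel :: "complex \<Rightarrow> complex" where "rel z = f z / growth a b lam z"

text \<open>Asymptotic equivalence counts 0/0 as 1. Since \<open>growth\<close> has no zeros of
  modulus above 1, the plain quotient has the same limit.\<close>

lemma rel_tendsto: "(rel \<longlongrightarrow> 1) (inf at_infinity (principal {z. \<bar>Arg z\<bar> \<le> \<theta>}))"
proof -
  have "\<forall>\<^sub>F z in inf at_infinity (principal {z. \<bar>Arg z\<bar> \<le> \<theta>}). growth a b lam z \<noteq> 0"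
    unfolding eventually_inf_principal eventually_at_infinity
    by (rule exI[of _ 2]) (auto intro!: growth_nonzero)
  then show ?thesis
    unfolding rel_def using inside_sector
    by (intro asymp_equivD_strong) (auto elim: eventually_mono)
qed

lemma rel_sequence:
  assumes "filterlim (\<lambda>k. norm (z k)) at_top sequentially" "\<forall>\<^sub>F k in sequentially. \<bar>Arg (z k)\<bar> \<le> \<theta>"
  shows "(\<lambda>k. rel (z k)) \<longlonglongrightarrow> 1"
proof (rule filterlim_compose[OF rel_tendsto])
  show "filterlim z (inf at_infinity (principal {z. \<bar>Arg z\<bar> \<le> \<theta>})) sequentially"
    using assms by (simp add: filterlim_inf filterlim_principal filterlim_norm_at_top_imp_at_infinity)
qed

lemma rel_bounds: "\<exists>R. \<forall>z. R \<le> norm z \<and> \<bar>Arg z\<bar> \<le> \<theta> \<longrightarrow> norm (rel z) \<le> 2"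
proof -
  have "\<forall>\<^sub>F z in inf at_infinity (principal {z. \<bar>Arg z\<bar> \<le> \<theta>}). norm (rel z) < 2"
    using tendsto_norm[OF rel_tendsto] by (rule order_tendstoD) simp
  then obtain R where R: "\<And>z. R \<le> norm z \<Longrightarrow> \<bar>Arg z\<bar> \<le> \<theta> \<Longrightarrow> norm (rel z) < 2"
    unfolding eventually_inf_principal eventually_at_infinity by auto
  then show ?thesis by (meson less_imp_le)
qed

lemma outer_bounds:
  "\<exists>R. \<exists>C > 0. \<forall>z. R \<le> norm z \<and> \<theta> < \<bar>Arg z\<bar> \<longrightarrow> norm (f z) \<le> C * exp (\<mu> * norm z powr lam)"
proof -
  obtain C where C: "C > 0" "\<forall>\<^sub>F z in inf at_infinity (principal {z. \<bar>Arg z\<bar> > \<theta>}).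
      norm (norm (f z)) \<le> C * norm (exp (\<mu> * norm z powr lam))"
    using outside_sector by (auto elim!: landau_o.bigE)
  then obtain R where R: "\<And>z. R \<le> norm z \<Longrightarrow> \<theta> < \<bar>Arg z\<bar> \<Longrightarrow> norm (f z) \<le> C * exp (\<mu> * norm z powr lam)"
    unfolding eventually_inf_principal eventually_at_infinity by auto
  then show ?thesis using C(1) by blast
qed

text \<open>
  \<open>2\<pi>\<close> times the integrand of the Cauchy remainder of \<open>f\<close> at \<open>r\<^sub>n u\<close>, divided by \<open>f (r\<^sub>n u)\<close> and
  rescaled to \<open>s = t \<surd>(\<lambda>n)\<close>.
\<close>
definition kernel :: "nat \<Rightarrow> complex \<Rightarrow> real \<Rightarrow> complex" where
  "kernel n u s = (let t = s / sqrt (lam * n); \<zeta> = cis t; r = complex_of_real (scale_radius lam n) in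
     if \<bar>t\<bar> \<le> pi then (u / \<zeta>) ^ n * (f (r * \<zeta>) / f (r * u)) * \<zeta> / (of_real (sqrt (lam * n)) * (\<zeta> - u)) else 0)"

text \<open>The substitution \<open>t = s / sqrt (lam * n)\<close> is an affine change of variables
  in the circle integral. Extension by zero puts all \<open>n\<close> on the common domain
  \<open>UNIV\<close>, as dominated convergence requires.\<close>

lemma kernel_has_integral:
  assumes n: "0 < n" and u: "norm u < 1" and f0: "f (of_real (scale_radius lam n) * u) \<noteq> 0"
  shows "(kernel n u has_integral 2 * of_real pi *
     (1 - taylor_partial_sum f (n - 1) (of_real (scale_radius lam n) * u) / f (of_real (scale_radius lam n) * u))) UNIV"
proof -
  define r where "r = scale_radius lam n"
  define m where "m = sqrt (lam * n)"
  define z where "z = of_real r * u"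
  have r: "0 < r" using lam n by (simp add: r_def scale_radius_def)
  have m: "0 < m" using lam n by (simp add: m_def)
  have z: "norm z < r" using u r by (simp add: z_def norm_mult)
  have "((\<lambda>t. (z / (of_real r * cis t)) ^ n * f (of_real r * cis t) * (of_real r * cis t) / (of_real r * cis t - z))
           has_integral 2 * of_real pi * (f z - taylor_partial_sum f (n - 1) z)) (cbox (-pi) pi)"
    using taylor_remainder_circle[OF entire z n] by simp
  from has_integral_affinity'[OF this, of "1 / m" 0] m
  have "((\<lambda>s. (z / (of_real r * cis (s / m))) ^ n * f (of_real r * cis (s / m)) * (of_real r * cis (s / m)) / (of_real r * cis (s / m) - z))
           has_integral of_real m * (2 * of_real pi * (f z - taylor_partial_sum f (n - 1) z))) {-pi * m..pi * m}"
    by (simp add: scaleR_conv_of_real mult_ac)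
  note int = has_integral_mult_right[OF this, of "1 / (of_real m * f z)"]
  have "f z \<noteq> 0" using f0 by (simp add: z_def r_def)
  then have "1 / (of_real m * f z) * (of_real m * (2 * of_real pi * (f z - taylor_partial_sum f (n - 1) z)))
     = 2 * of_real pi * (1 - taylor_partial_sum f (n - 1) z / f z)"
    using m by (simp add: field_simps)
  from has_integral_eq_rhs[OF int this[symmetric]] have "((\<lambda>s. 1 / (of_real m * f z) * ((z / (of_real r * cis (s / m))) ^ n * f (of_real r * cis (s / m)) * (of_real r * cis (s / m)) / (of_real r * cis (s / m) - z)))
           has_integral 2 * of_real pi * (1 - taylor_partial_sum f (n - 1) z / f z)) {-pi * m..pi * m}" .
  then have "((\<lambda>s. if s \<in> {-pi * m..pi * m} then 1 / (of_real m * f z) * ((z / (of_real r * cis (s / m))) ^ n * f (of_real r * cis (s / m)) * (of_real r * cis (s / m)) / (of_real r * cis (s / m) - z)) else 0)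
           has_integral 2 * of_real pi * (1 - taylor_partial_sum f (n - 1) z / f z)) UNIV"
    by (simp only: has_integral_restrict_UNIV)
  moreover have "(if s \<in> {-pi * m..pi * m} then 1 / (of_real m * f z) * ((z / (of_real r * cis (s / m))) ^ n * f (of_real r * cis (s / m)) * (of_real r * cis (s / m)) / (of_real r * cis (s / m) - z)) else 0)
     = kernel n u s" for s
  proof -
    have iff: "s \<in> {-pi * m..pi * m} \<longleftrightarrow> \<bar>s / m\<bar> \<le> pi"
      using m by (auto simp: abs_le_iff field_simps)
    have "of_real r * cis (s / m) - z = of_real r * (cis (s / m) - u)"
      by (simp add: z_def right_diff_distrib)
    then show ?thesis
      using r m unfolding iff kernel_def Let_def m_def[symmetric] r_def[symmetric]
      by (simp add: z_def mult_ac)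
  qed
  ultimately show ?thesis
    by (simp add: z_def r_def)
qed

section \<open>The kernel on the inner and on the outer arc\<close>

lemma growth_scaled:
  assumes n: "0 < n" and r: "exp pi < scale_radius lam n" and u: "u \<noteq> 0" "norm (Ln u) \<le> pi"
  shows "growth a b lam (of_real (scale_radius lam n) * u) =
     saddle_constant a b lam n * u ^ n * exp (saddle_exponent a b lam n (Ln u))"
proof -
  have "1 < scale_radius lam n" using r one_less_exp_iff[of pi] by (smt (verit) pi_gt_zero)
  then have lnR: "pi < ln (scale_radius lam n)"
    using r ln_less_cancel_iff[of "exp pi" "scale_radius lam n"] by simp
  \<comment> \<open>The assumption \<open>exp pi < scale_radius lam n\<close> makes the real
    logarithm exceed \<open>pi\<close>, hence exceed \<open>norm (Ln u)\<close>, so the sum cannot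
    vanish.\<close>
  have ne: "of_real (ln (scale_radius lam n)) + Ln u \<noteq> 0"
  proof
    assume "of_real (ln (scale_radius lam n)) + Ln u = 0"
    then have "Ln u = - of_real (ln (scale_radius lam n))" by (simp add: eq_neg_iff_add_eq_0 add.commute)
    then have "norm (Ln u) = \<bar>ln (scale_radius lam n)\<bar>" by (simp only: norm_minus_cancel norm_of_real)
    then show False using u lnR by simp
  qed
  show ?thesis
    using growth_exp[OF lam n \<open>1 < scale_radius lam n\<close> mpi_less_Im_Ln Im_Ln_le_pi ne] u
    by (simp add: exp_of_nat_mult)
qed

text \<open>Both values of \<open>f\<close> are written as \<open>rel\<close> times
  \<open>growth\<close>. The saddle constants cancel in the quotient, and the powers
  \<open>u ^ n\<close> and \<open>\<zeta> ^ n\<close> cancel against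
  \<open>(u / \<zeta>) ^ n\<close>, leaving a difference of saddle exponents.\<close>

lemma kernel_inner:
  assumes n: "0 < n" and r: "exp pi < scale_radius lam n" and s: "\<bar>s / sqrt (lam * n)\<bar> \<le> \<theta>"
    and u: "u \<noteq> 0" "norm (Ln u) \<le> pi"
  shows "kernel n u s = rel (of_real (scale_radius lam n) * cis (s / sqrt (lam * n))) / rel (of_real (scale_radius lam n) * u)
     * exp (saddle_exponent a b lam n (\<i> * of_real (s / sqrt (lam * n))) - saddle_exponent a b lam n (Ln u))
     * cis (s / sqrt (lam * n)) / (of_real (sqrt (lam * n)) * (cis (s / sqrt (lam * n)) - u))"
proof -
  define R where "R = scale_radius lam n"
  define t where "t = s / sqrt (lam * n)"
  have t: "\<bar>t\<bar> < pi" using s theta by (simp add: t_def)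
  have Ln_t: "Ln (cis t) = \<i> * of_real t" using Ln_cis[of t] t by (simp add: abs_less_iff)
  have A1: "growth a b lam (of_real R * cis t) = saddle_constant a b lam n * cis t ^ n * exp (saddle_exponent a b lam n (\<i> * of_real t))"
    using growth_scaled[OF n r, of "cis t"] t by (simp add: Ln_t R_def norm_mult)
  have A2: "growth a b lam (of_real R * u) = saddle_constant a b lam n * u ^ n * exp (saddle_exponent a b lam n (Ln u))"
    using growth_scaled[OF n r u] by (simp add: R_def)
  have nz: "saddle_constant a b lam n \<noteq> 0" by (simp add: saddle_constant_def)
  have "f (of_real R * cis t) = rel (of_real R * cis t) * growth a b lam (of_real R * cis t)"
    using nz by (simp add: rel_def A1)
  moreover have "f (of_real R * u) = rel (of_real R * u) * growth a b lam (of_real R * u)"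
    using nz u by (simp add: rel_def A2)
  ultimately have "(u / cis t) ^ n * (f (of_real R * cis t) / f (of_real R * u)) = rel (of_real R * cis t) / rel (of_real R * u)
     * exp (saddle_exponent a b lam n (\<i> * of_real t) - saddle_exponent a b lam n (Ln u))"
    using nz u by (simp add: A1 A2 exp_diff power_divide)
  then show ?thesis
    using t by (simp add: kernel_def Let_def R_def t_def)
qed


lemma theta_bounds: "\<theta> < pi" "lam * \<theta> < pi"
  using theta lam by (auto simp: field_simps)

text \<open>The lower bound for \<open>f\<close> at \<open>r u\<close> contains
  \<open>norm u ^ n\<close>, which cancels the same factor of the kernel. What remains is the
  quotient of \<open>exp (\<mu> n / lam)\<close> by the saddle constant, which decays exponentially.
  A point \<open>\<zeta>\<close> of the unit circle has distance at least \<open>1 - norm u\<close>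
  from \<open>u\<close>, so \<open>c\<close> bounds the denominator.\<close>

lemma kernel_outer:
  assumes n: "0 < n" and r: "exp pi < scale_radius lam n"
    and s: "\<theta> < \<bar>s / sqrt (lam * n)\<bar>" "\<bar>s / sqrt (lam * n)\<bar> \<le> pi"
    and C: "norm (f (of_real (scale_radius lam n) * cis (s / sqrt (lam * n)))) \<le> C * exp (\<mu> * (real n / lam))"
    and u: "u \<noteq> 0" "norm u < 1" "norm (Ln u) \<le> pi" "1 / 2 \<le> norm (rel (of_real (scale_radius lam n) * u))"
    and M: "- M \<le> Re (saddle_exponent a b lam n (Ln u))"
    and c: "0 < c" "c \<le> sqrt (lam * n) * (1 - norm u)"
    and const: "exp (\<mu> * (real n / lam)) / norm (saddle_constant a b lam n)
      \<le> exp (- ((1 - \<mu>) / (2 * lam)) * real n)"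
  shows "norm (kernel n u s) \<le> 2 * C * exp M / c * exp (- ((1 - \<mu>) / (2 * lam)) * real n)"
proof -
  define R where "R = scale_radius lam n"
  define \<zeta> where "\<zeta> = cis (s / sqrt (lam * n))"
  define m where "m = sqrt (lam * n)"
  define S where "S = norm (saddle_constant a b lam n)"
  have S: "0 < S" by (simp add: S_def saddle_constant_def)
  have \<zeta>: "norm \<zeta> = 1" by (simp add: \<zeta>_def)
  have m: "0 < m" using lam n by (simp add: m_def)
  have "growth a b lam (of_real R * u) = saddle_constant a b lam n * u ^ n * exp (saddle_exponent a b lam n (Ln u))"
    using growth_scaled[OF n r u(1) u(3)] by (simp add: R_def)
  moreover from this have "f (of_real R * u) = rel (of_real R * u) * growth a b lam (of_real R * u)"
    using S u by (simp add: rel_def S_def)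
  ultimately have fu: "norm (f (of_real R * u)) = norm (rel (of_real R * u)) * (S * norm u ^ n * exp (Re (saddle_exponent a b lam n (Ln u))))"
    by (simp add: norm_mult norm_power S_def)
  have "1 / 2 * (S * norm u ^ n * exp (- M)) \<le> norm (f (of_real R * u))"
    unfolding fu using u M S by (intro mult_mono) (auto simp: R_def)
  moreover have low: "0 < 1 / 2 * (S * norm u ^ n * exp (- M))" using S u by simp
  ultimately have fu': "norm (f (of_real R * \<zeta>)) / norm (f (of_real R * u)) \<le> C * exp (\<mu> * (real n / lam)) / (1 / 2 * (S * norm u ^ n * exp (- M)))"
    using C by (intro frac_le) (auto simp: R_def \<zeta>_def intro: order.trans[OF norm_ge_zero])
  have "1 - norm u \<le> norm (\<zeta> - u)" using norm_triangle_ineq2[of \<zeta> u] \<zeta> by simp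
  then have den: "c \<le> m * norm (\<zeta> - u)"
    using c m by (auto simp: m_def intro: order.trans mult_left_mono)
  have "norm (kernel n u s) = norm u ^ n * (norm (f (of_real R * \<zeta>)) / norm (f (of_real R * u))) / (m * norm (\<zeta> - u))"
    using s m \<zeta> by (simp add: kernel_def Let_def R_def \<zeta>_def m_def norm_mult norm_divide norm_power)
  also have "\<dots> \<le> norm u ^ n * (C * exp (\<mu> * (real n / lam)) / (1 / 2 * (S * norm u ^ n * exp (- M)))) / c"
  proof (rule frac_le)
    have "0 \<le> norm (f (of_real R * \<zeta>)) / norm (f (of_real R * u))" by simp
    from order.trans[OF this fu'] show "0 \<le> norm u ^ n * (C * exp (\<mu> * (real n / lam)) / (1 / 2 * (S * norm u ^ n * exp (- M))))"
      by (rule mult_nonneg_nonneg[rotated]) simp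
    show "norm u ^ n * (norm (f (of_real R * \<zeta>)) / norm (f (of_real R * u)))
       \<le> norm u ^ n * (C * exp (\<mu> * (real n / lam)) / (1 / 2 * (S * norm u ^ n * exp (- M))))"
      by (rule mult_left_mono[OF fu']) simp
  qed (use den c in auto)
  also have "\<dots> = 2 * C * exp M / c * (exp (\<mu> * (real n / lam)) / S)"
    using u S c by (simp add: exp_minus field_simps)
  also have "\<dots> \<le> 2 * C * exp M / c * exp (- ((1 - \<mu>) / (2 * lam)) * real n)"
  proof (rule mult_left_mono)
    have "0 \<le> C * exp (\<mu> * (real n / lam))" using C norm_ge_zero order.trans by blast
    then have "0 \<le> C" by (simp add: zero_le_mult_iff)
    then show "0 \<le> 2 * C * exp M / c" using c by simp
  qed (use const in \<open>simp add: S_def\<close>)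
  finally show ?thesis .
qed

text \<open>In the variable \<open>s\<close> the quadratic decay
  \<open>2 * lam / pi\<^sup>2 * (n * t\<^sup>2)\<close> is
  \<open>2 / pi\<^sup>2 * s\<^sup>2\<close>, free of \<open>n\<close>. The constant 4 is the
  quotient of the bounds 2 and 1/2 for \<open>rel\<close>.\<close>

lemma kernel_inner_bound:
  assumes n: "0 < n" and r: "exp pi < scale_radius lam n" and s: "\<bar>s / sqrt (lam * n)\<bar> \<le> \<theta>"
    and q: "norm (rel (of_real (scale_radius lam n) * cis (s / sqrt (lam * n)))) \<le> 2"
    and u: "u \<noteq> 0" "norm u < 1" "norm (Ln u) \<le> pi" "1 / 2 \<le> norm (rel (of_real (scale_radius lam n) * u))"
    and M: "- M \<le> Re (saddle_exponent a b lam n (Ln u))"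
    and c: "0 < c" "c \<le> sqrt (lam * n) * (1 - norm u)"
    and B: "Re (saddle_exponent a b lam n (\<i> * of_real (s / sqrt (lam * n))))
       \<le> B - 2 * lam / pi\<^sup>2 * (real n * (s / sqrt (lam * n))\<^sup>2)"
  shows "norm (kernel n u s) \<le> 4 * exp (B + M) / c * exp (- (2 / pi\<^sup>2) * s\<^sup>2)"
proof -
  define R where "R = scale_radius lam n"
  define \<zeta> where "\<zeta> = cis (s / sqrt (lam * n))"
  define m where "m = sqrt (lam * n)"
  define X where "X = Re (saddle_exponent a b lam n (\<i> * of_real (s / sqrt (lam * n)))) - Re (saddle_exponent a b lam n (Ln u))"
  have \<zeta>: "norm \<zeta> = 1" by (simp add: \<zeta>_def)
  have m: "0 < m" using lam n by (simp add: m_def)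
  have "2 * lam / pi\<^sup>2 * (real n * (s / sqrt (lam * n))\<^sup>2) = 2 / pi\<^sup>2 * s\<^sup>2"
    using lam n by (simp add: power_divide)
  then have X: "X \<le> B + M + (- (2 / pi\<^sup>2) * s\<^sup>2)" unfolding X_def using B M by linarith
  have "1 - norm u \<le> norm (\<zeta> - u)" using norm_triangle_ineq2[of \<zeta> u] \<zeta> by simp
  then have den: "c \<le> m * norm (\<zeta> - u)"
    using c m by (auto simp: m_def intro: order.trans mult_left_mono)
  have "norm (kernel n u s) = norm (rel (of_real R * \<zeta>)) / norm (rel (of_real R * u)) * exp X / (m * norm (\<zeta> - u))"
    using m \<zeta> by (simp add: kernel_inner[OF n r s u(1) u(3)] R_def \<zeta>_def m_def X_def norm_mult norm_divide)
  also have "\<dots> \<le> 2 / (1 / 2) * exp (B + M + (- (2 / pi\<^sup>2) * s\<^sup>2)) / c"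
    using q u den c X by (intro frac_le mult_mono) (auto simp: R_def \<zeta>_def)
  also have "\<dots> = 4 * exp (B + M) / c * exp (- (2 / pi\<^sup>2) * s\<^sup>2)"
    by (simp only: exp_add) simp
  finally show ?thesis .
qed

text \<open>Three ranges of \<open>t = s / sqrt (lam * n)\<close> are combined: Gaussian decay up to
  \<open>\<theta>\<close>, exponential decay in \<open>n\<close> from \<open>\<theta>\<close> to
  \<open>pi\<close>, and the value zero beyond.\<close>

lemma kernel_dominated:
  assumes N: "filterlim N at_top sequentially" and u: "u \<longlonglongrightarrow> 1"
    and g: "(\<lambda>k. saddle_exponent a b lam (N k) (Ln (u k))) \<longlonglongrightarrow> G"
    and q: "(\<lambda>k. rel (of_real (scale_radius lam (N k)) * u k)) \<longlonglongrightarrow> 1"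
    and d: "0 < d" "\<forall>\<^sub>F k in sequentially. d \<le> sqrt (N k) * (1 - norm (u k))"
  shows "\<exists>D \<kappa>. 0 < \<kappa> \<and> (\<forall>\<^sub>F k in sequentially. \<forall>s. norm (kernel (N k) (u k) s) \<le> D * exp (- \<kappa> * s\<^sup>2))"
proof -
  obtain R1 where R1: "\<And>z. R1 \<le> norm z \<Longrightarrow> \<bar>Arg z\<bar> \<le> \<theta> \<Longrightarrow> norm (rel z) \<le> 2"
    using rel_bounds by blast
  obtain R2 C where R2: "C > 0" "\<And>z. R2 \<le> norm z \<Longrightarrow> \<theta> < \<bar>Arg z\<bar> \<Longrightarrow> norm (f z) \<le> C * exp (\<mu> * norm z powr lam)"
    using outer_bounds by blast
  \<comment> \<open>Eventually the real part of the exponent at \<open>u k\<close> exceeds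
    \<open>Re G - 1\<close>, which is \<open>- M\<close>.\<close>
  define M where "M = 1 - Re G"
  define B where "B = norm a * pi + norm b"
  define c where "c = sqrt lam * d"
  have c: "c > 0" using d lam by (simp add: c_def)
  define D1 where "D1 = 4 * exp (B + M) / c"
  define D2 where "D2 = 2 * C * exp M / c"
  have D: "0 \<le> D1" "0 \<le> D2" using c R2 by (auto simp: D1_def D2_def)
  define \<delta> where "\<delta> = (1 - \<mu>) / (2 * lam)"
  have \<delta>: "0 < \<delta>" using mu lam by (simp add: \<delta>_def)
  \<comment> \<open>The smaller of the decay rates from the inner and the outer arc.\<close>
  define \<kappa> where "\<kappa> = min (2 / pi\<^sup>2) (\<delta> / (lam * pi\<^sup>2))"
  have \<kappa>: "0 < \<kappa>" using \<delta> lam by (simp add: \<kappa>_def)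
  note ev = eventually_compose_filterlim[OF _ N]
  note rad = filterlim_scale_radius[OF lam, unfolded filterlim_at_top_dense, rule_format]
  have "(\<lambda>k. Ln (u k)) \<longlonglongrightarrow> Ln 1" by (intro tendsto_Ln u) auto
  then have ev_Ln: "\<forall>\<^sub>F k in sequentially. norm (Ln (u k)) < pi"
    by (intro order_tendstoD(2)[OF tendsto_norm]) auto
  have "\<forall>\<^sub>F k in sequentially. norm (u k) > 0"
    by (intro order_tendstoD(1)[OF tendsto_norm[OF u]]) auto
  moreover have "\<forall>\<^sub>F k in sequentially. norm (rel (of_real (scale_radius lam (N k)) * u k)) > 1 / 2"
    by (intro order_tendstoD(1)[OF tendsto_norm[OF q]]) auto
  moreover have "\<forall>\<^sub>F k in sequentially. Re (saddle_exponent a b lam (N k) (Ln (u k))) > - M"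
    by (intro order_tendstoD(1)[OF tendsto_Re[OF g]]) (auto simp: M_def)
  ultimately have "\<forall>\<^sub>F k in sequentially. \<forall>s. norm (kernel (N k) (u k) s) \<le> (D1 + D2) * exp (- \<kappa> * s\<^sup>2)"
    using d(2) ev_Ln ev[OF eventually_gt_at_top[of 0]] ev[OF rad[of R1]] ev[OF rad[of R2]] ev[OF rad[of "exp pi"]]
      ev[OF saddle_constant_dominates[OF lam mu, of a b]]
      ev[OF saddle_exponent_imaginary_bound[OF lam less_imp_le[OF theta_bounds(1)] less_imp_le[OF theta_bounds(2)], of a b]]
  proof eventually_elim
    case (elim k)
    define n where "n = N k"
    define R where "R = scale_radius lam n"
    have n: "0 < n" and r: "exp pi < scale_radius lam n" and R: "R1 < R" "R2 < R"
      using elim by (auto simp: n_def R_def)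
    have R0: "0 < R" using r exp_gt_zero[of pi] unfolding R_def by linarith
    have "0 < sqrt (N k) * (1 - norm (u k))" using elim d(1) by linarith
    then have u: "u k \<noteq> 0" "norm (u k) < 1" "norm (Ln (u k)) \<le> pi" "1 / 2 \<le> norm (rel (of_real (scale_radius lam n) * u k))"
      using elim by (auto simp: zero_less_mult_iff n_def)
    have M: "- M \<le> Re (saddle_exponent a b lam n (Ln (u k)))" using elim by (simp add: n_def)
    have cn: "c \<le> sqrt (lam * n) * (1 - norm (u k))"
      using elim lam by (simp add: c_def n_def real_sqrt_mult mult.assoc)
    show ?case
    proof
      fix s :: real
      define t where "t = s / sqrt (lam * n)"
      have pow: "R powr lam = real n / lam"
        using lam by (simp add: R_def scale_radius_def powr_powr)
      consider "\<bar>t\<bar> \<le> \<theta>" | "\<theta> < \<bar>t\<bar>" "\<bar>t\<bar> \<le> pi" | "pi < \<bar>t\<bar>" by linarith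
      then show "norm (kernel (N k) (u k) s) \<le> (D1 + D2) * exp (- \<kappa> * s\<^sup>2)"
      proof cases
        case 1
        have "norm (rel (of_real R * cis t)) \<le> 2"
          by (rule R1) (use 1 R R0 theta_bounds(1) Arg_of_real_cis[OF R0, of t] in \<open>auto simp: norm_mult\<close>)
        then have "norm (kernel n (u k) s) \<le> D1 * exp (- (2 / pi\<^sup>2) * s\<^sup>2)"
          using 1 elim(11)[rule_format, OF 1] unfolding t_def R_def D1_def n_def[symmetric] B_def[symmetric]
          by (intro kernel_inner_bound n r u M c cn)
        also have "\<dots> \<le> (D1 + D2) * exp (- \<kappa> * s\<^sup>2)"
        proof (intro mult_mono)
          have "\<kappa> * s\<^sup>2 \<le> 2 / pi\<^sup>2 * s\<^sup>2" by (intro mult_right_mono) (auto simp: \<kappa>_def)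
          then show "exp (- (2 / pi\<^sup>2) * s\<^sup>2) \<le> exp (- \<kappa> * s\<^sup>2)" by simp
        qed (use D in auto)
        finally show ?thesis by (simp add: n_def)
      next
        case 2
        have "norm (f (of_real R * cis t)) \<le> C * exp (\<mu> * norm (of_real R * cis t) powr lam)"
          by (rule R2) (use 2 R R0 circle_in_outer_sector[OF R0, of t \<theta>] in \<open>auto simp: norm_mult\<close>)
        then have "norm (f (of_real R * cis t)) \<le> C * exp (\<mu> * (real n / lam))"
          using R0 pow by (simp add: norm_mult)
        then have "norm (kernel n (u k) s) \<le> 2 * C * exp M / c * exp (- ((1 - \<mu>) / (2 * lam)) * real n)"
          by (intro kernel_outer n r u M c cn; use 2 elim in \<open>simp add: t_def n_def R_def\<close>)
        also have "\<dots> = D2 * exp (- \<delta> * real n)" by (simp add: D2_def \<delta>_def)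
        also have "\<dots> \<le> (D1 + D2) * exp (- \<kappa> * s\<^sup>2)"
        proof (intro mult_mono)
          \<comment> \<open>On the circle \<open>s\<^sup>2 \<le> lam * pi\<^sup>2 * n\<close>, so
            exponential decay in \<open>n\<close> implies Gaussian decay in
            \<open>s\<close>.\<close>
          have "t\<^sup>2 \<le> pi\<^sup>2" using 2 power_mono[of "\<bar>t\<bar>" pi 2] by simp
          then have "s\<^sup>2 \<le> lam * pi\<^sup>2 * n" using lam n by (simp add: t_def power_divide field_simps)
          then have "\<delta> / (lam * pi\<^sup>2) * s\<^sup>2 \<le> \<delta> / (lam * pi\<^sup>2) * (lam * pi\<^sup>2 * n)"
            using \<delta> lam by (intro mult_left_mono) auto
          moreover have "\<kappa> * s\<^sup>2 \<le> \<delta> / (lam * pi\<^sup>2) * s\<^sup>2" by (intro mult_right_mono) (auto simp: \<kappa>_def)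
          ultimately show "exp (- \<delta> * real n) \<le> exp (- \<kappa> * s\<^sup>2)" using lam by simp
        qed (use D in auto)
        finally show ?thesis by (simp add: n_def)
      next
        case 3
        then have "kernel n (u k) s = 0" by (simp add: kernel_def t_def Let_def)
        then show ?thesis using D by (simp add: n_def)
      qed
    qed
  qed
  with \<kappa> show ?thesis by blast
qed

text \<open>For fixed \<open>s\<close> the angle \<open>t k\<close> tends to 0, so the inner formula
  eventually applies and each of its factors converges. The exponent at \<open>\<i> t\<close>
  contributes \<open>- s\<^sup>2 / 2\<close>, and the limit of the denominator is nonzero because
  its real part is \<open>- sqrt lam * Re w\<close>.\<close>

lemma kernel_tendsto:
  assumes N: "filterlim N at_top sequentially" and u: "u \<longlonglongrightarrow> 1"
    and w: "(\<lambda>k. of_real (sqrt (N k)) * (u k - 1)) \<longlonglongrightarrow> w" and Rew: "Re w < 0"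
    and g: "(\<lambda>k. saddle_exponent a b lam (N k) (Ln (u k))) \<longlonglongrightarrow> of_real lam * w\<^sup>2 / 2"
    and q: "(\<lambda>k. rel (of_real (scale_radius lam (N k)) * u k)) \<longlonglongrightarrow> 1"
  shows "(\<lambda>k. kernel (N k) (u k) s) \<longlonglongrightarrow>
     exp (- (of_real (s\<^sup>2) / 2) - (of_real (sqrt lam) * w)\<^sup>2 / 2) / (\<i> * of_real s - of_real (sqrt lam) * w)"
proof -
  define r where "r k = scale_radius lam (N k)" for k
  define m where "m = (\<lambda>k. sqrt (lam * N k))"
  define t where "t = (\<lambda>k. s / m k)"
  note ev = eventually_compose_filterlim[OF _ N]
  note rad = filterlim_compose[OF filterlim_scale_radius[OF lam] N]
  have sl: "sqrt lam > 0" using lam by simp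
  have m: "filterlim m at_top sequentially"
    unfolding m_def
    by (rule filterlim_compose[OF sqrt_at_top] filterlim_tendsto_pos_mult_at_top[OF tendsto_const lam]
          filterlim_compose[OF filterlim_real_sequentially N])+
  have t: "t \<longlonglongrightarrow> 0"
    unfolding t_def by (rule real_tendsto_divide_at_top[OF tendsto_const m])
  have ev_t: "\<forall>\<^sub>F k in sequentially. \<bar>t k\<bar> < \<theta>"
    using tendsto_rabs[OF t] theta(1) by (intro order_tendstoD(2)) auto
  have it0: "(\<lambda>k. \<i> * complex_of_real (t k)) \<longlonglongrightarrow> 0"
    using tendsto_mult[OF tendsto_const[of \<i>] tendsto_of_real[OF t]] by simp
  have it: "(\<lambda>k. of_real (sqrt (N k)) * (\<i> * of_real (t k))) \<longlonglongrightarrow> \<i> * of_real (s / sqrt lam)"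
  proof (rule tendsto_eventually)
    show "\<forall>\<^sub>F k in sequentially. of_real (sqrt (N k)) * (\<i> * of_real (t k)) = \<i> * of_real (s / sqrt lam)"
      using ev[OF eventually_gt_at_top[of 0]]
      by eventually_elim (use lam in \<open>simp add: t_def m_def real_sqrt_mult\<close>)
  qed
  have cis: "(\<lambda>k. cis (t k)) \<longlonglongrightarrow> 1"
    using tendsto_exp[OF it0] by (simp add: cis_conv_exp)
  have gt: "(\<lambda>k. saddle_exponent a b lam (N k) (\<i> * of_real (t k))) \<longlonglongrightarrow> of_real lam * (\<i> * of_real (s / sqrt lam))\<^sup>2 / 2"
    by (rule saddle_exponent_tendsto[OF lam N it])
  have qt: "(\<lambda>k. rel (of_real (r k) * cis (t k))) \<longlonglongrightarrow> 1"
  proof (rule rel_sequence)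
    have pos: "\<forall>\<^sub>F k in sequentially. r k > 0"
      unfolding r_def using rad by (simp add: filterlim_at_top_dense)
    then show "\<forall>\<^sub>F k in sequentially. \<bar>Arg (of_real (r k) * cis (t k))\<bar> \<le> \<theta>"
      using ev_t
    proof eventually_elim
      case (elim k)
      then have "Arg (of_real (r k) * cis (t k)) = t k"
        using theta_bounds(1) by (intro Arg_of_real_cis) auto
      with elim show ?case by simp
    qed
    have "\<forall>\<^sub>F k in sequentially. r k = norm (of_real (r k) * cis (t k))"
      using pos by eventually_elim (simp add: norm_mult)
    from filterlim_cong[OF refl refl this]
    show "filterlim (\<lambda>k. norm (of_real (r k) * cis (t k))) at_top sequentially"
      using rad by (simp add: r_def)
  qed
  have den: "(\<lambda>k. of_real (m k) * (cis (t k) - u k)) \<longlonglongrightarrow> \<i> * of_real s - of_real (sqrt lam) * w"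
  proof -
    \<comment> \<open>Both \<open>cis (t k)\<close> and \<open>u k\<close> differ from 1 by order
      \<open>1 / sqrt N\<close>, so 1 is subtracted from each before scaling.\<close>
    have "(\<lambda>k. of_real (sqrt (N k)) * (exp (\<i> * of_real (t k)) - 1)) \<longlonglongrightarrow> 1 * (\<i> * of_real (s / sqrt lam))"
      by (rule scaled_tendsto_derivative[OF _ _ it0 it]) (auto intro!: derivative_eq_intros)
    from tendsto_mult[OF tendsto_const[of "of_real (sqrt lam)"] tendsto_diff[OF this w]]
    have "(\<lambda>k. of_real (sqrt lam) * (of_real (sqrt (N k)) * (exp (\<i> * of_real (t k)) - 1) - of_real (sqrt (N k)) * (u k - 1)))
        \<longlonglongrightarrow> of_real (sqrt lam) * (1 * (\<i> * of_real (s / sqrt lam)) - w)" .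
    moreover have "of_real (sqrt lam) * (1 * (\<i> * of_real (s / sqrt lam)) - w) = \<i> * of_real s - of_real (sqrt lam) * w"
      using sl by (simp add: right_diff_distrib)
    moreover have "of_real (sqrt lam) * (of_real (sqrt (N k)) * (exp (\<i> * of_real (t k)) - 1) - of_real (sqrt (N k)) * (u k - 1))
       = of_real (m k) * (cis (t k) - u k)" for k
      by (simp add: m_def real_sqrt_mult cis_conv_exp algebra_simps)
    ultimately show ?thesis by simp
  qed
  have nz: "\<i> * of_real s - of_real (sqrt lam) * w \<noteq> 0"
  proof
    assume "\<i> * of_real s - of_real (sqrt lam) * w = 0"
    then have "Re (\<i> * of_real s - of_real (sqrt lam) * w) = 0" by simp
    then show False using sl Rew by simp
  qed
  have "(\<lambda>k. rel (of_real (r k) * cis (t k)) / rel (of_real (r k) * u k)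
     * exp (saddle_exponent a b lam (N k) (\<i> * of_real (t k)) - saddle_exponent a b lam (N k) (Ln (u k)))
     * cis (t k) / (of_real (m k) * (cis (t k) - u k))) \<longlonglongrightarrow>
     1 / 1 * exp (of_real lam * (\<i> * of_real (s / sqrt lam))\<^sup>2 / 2 - of_real lam * w\<^sup>2 / 2) * 1 / (\<i> * of_real s - of_real (sqrt lam) * w)"
    by (intro tendsto_intros qt q[folded r_def] gt g cis den nz) auto
  moreover have "\<forall>\<^sub>F k in sequentially. rel (of_real (r k) * cis (t k)) / rel (of_real (r k) * u k)
     * exp (saddle_exponent a b lam (N k) (\<i> * of_real (t k)) - saddle_exponent a b lam (N k) (Ln (u k)))
     * cis (t k) / (of_real (m k) * (cis (t k) - u k)) = kernel (N k) (u k) s"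
  proof -
    have "(\<lambda>k. Ln (u k)) \<longlonglongrightarrow> Ln 1" by (intro tendsto_Ln u) auto
    then have "\<forall>\<^sub>F k in sequentially. norm (Ln (u k)) < pi"
      by (intro order_tendstoD(2)[OF tendsto_norm]) auto
    moreover have "\<forall>\<^sub>F k in sequentially. norm (u k) > 0"
      by (intro order_tendstoD(1)[OF tendsto_norm[OF u]]) auto
    moreover have "\<forall>\<^sub>F k in sequentially. r k > exp pi"
      unfolding r_def using rad by (simp add: filterlim_at_top_dense)
    ultimately show ?thesis
      using ev_t ev[OF eventually_gt_at_top[of 0]]
    proof eventually_elim
      case (elim k)
      then show ?case
        using kernel_inner[of "N k" s "u k"] by (simp add: t_def m_def r_def)
    qed
  qed
  ultimately have "(\<lambda>k. kernel (N k) (u k) s) \<longlonglongrightarrow>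
     1 / 1 * exp (of_real lam * (\<i> * of_real (s / sqrt lam))\<^sup>2 / 2 - of_real lam * w\<^sup>2 / 2) * 1 / (\<i> * of_real s - of_real (sqrt lam) * w)"
    by (rule Lim_transform_eventually)
  moreover have "of_real lam * (\<i> * of_real (s / sqrt lam))\<^sup>2 / 2 - of_real lam * w\<^sup>2 / 2 = - (of_real (s\<^sup>2) / 2) - (of_real (sqrt lam) * w)\<^sup>2 / 2"
    using lam by (simp add: power_mult_distrib power_divide flip: of_real_power)
  ultimately show ?thesis by simp
qed

text \<open>Dominated convergence gives \<open>2 pi (1 - \<rho> k) \<longlonglongrightarrow> pi *
  erfc (- v / sqrt 2)\<close> with \<open>v = sqrt lam * w0\<close>. Solving for
  \<open>\<rho> k\<close> and reflecting \<open>erfc\<close> yields the limit.\<close>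

lemma partial_sum_ratio_tendsto:
  assumes N: "filterlim N at_top sequentially" and w: "w \<longlonglongrightarrow> w0" and Rew: "Re w0 < 0"
  shows "(\<lambda>k. taylor_partial_sum f (N k - 1) (of_real (scale_radius lam (N k)) * (1 + w k / of_real (sqrt (N k))))
      / f (of_real (scale_radius lam (N k)) * (1 + w k / of_real (sqrt (N k)))))
     \<longlonglongrightarrow> erfc (w0 * of_real (sqrt (lam / 2))) / 2"
proof -
  define x where "x = (\<lambda>k. w k / of_real (sqrt (N k)))"
  define u where "u = (\<lambda>k. 1 + x k)"
  define z where "z = (\<lambda>k. of_real (scale_radius lam (N k)) * u k)"
  define v where "v = of_real (sqrt lam) * w0"
  define \<rho> where "\<rho> = (\<lambda>k. taylor_partial_sum f (N k - 1) (z k) / f (z k))"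
  note ev = eventually_compose_filterlim[OF _ N]
  note rad = filterlim_compose[OF filterlim_scale_radius[OF lam] N]
  have rootN: "filterlim (\<lambda>k. sqrt (N k)) at_top sequentially"
    by (rule filterlim_compose[OF sqrt_at_top filterlim_compose[OF filterlim_real_sequentially N]])
  have inv: "(\<lambda>k. inverse (sqrt (N k))) \<longlonglongrightarrow> 0"
    by (rule tendsto_inverse_0_at_top[OF rootN])
  have x: "x \<longlonglongrightarrow> 0"
    using tendsto_mult[OF w tendsto_of_real[OF inv]] by (simp add: x_def divide_inverse)
  have u: "u \<longlonglongrightarrow> 1" using tendsto_add[OF tendsto_const[of 1] x] by (simp add: u_def)
  have xw: "(\<lambda>k. of_real (sqrt (N k)) * x k) \<longlonglongrightarrow> w0"
  proof (rule Lim_transform_eventually[OF w])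
    show "\<forall>\<^sub>F k in sequentially. w k = of_real (sqrt (N k)) * x k"
      using ev[OF eventually_gt_at_top[of 0]] by eventually_elim (simp add: x_def)
  qed
  \<comment> \<open>Passing from \<open>x k\<close> to \<open>Ln (1 + x k)\<close> keeps the scaled
    limit \<open>w0\<close>, since the logarithm has derivative 1 at 1.\<close>
  have "(\<lambda>k. of_real (sqrt (N k)) * Ln (1 + x k)) \<longlonglongrightarrow> 1 * w0"
    by (rule scaled_tendsto_derivative[where F = "\<lambda>x. Ln (1 + x)", OF _ _ x xw]) (auto intro!: derivative_eq_intros)
  then have g: "(\<lambda>k. saddle_exponent a b lam (N k) (Ln (u k))) \<longlonglongrightarrow> of_real lam * w0\<^sup>2 / 2"
    by (intro saddle_exponent_tendsto[OF lam N]) (simp add: u_def)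
  have q: "(\<lambda>k. rel (z k)) \<longlonglongrightarrow> 1"
  proof (rule rel_sequence)
    \<comment> \<open>Multiplication by the positive radius leaves \<open>Arg\<close> unchanged, so
      convergence of \<open>Arg (u k)\<close> to 0 places \<open>z k\<close> in the inner
      sector.\<close>
    have "(\<lambda>k. Arg (u k)) \<longlonglongrightarrow> Arg 1"
      by (rule isCont_tendsto_compose[OF continuous_at_Arg u]) auto
    then have "\<forall>\<^sub>F k in sequentially. \<bar>Arg (u k)\<bar> < \<theta>"
      using theta(1) by (intro order_tendstoD(2)[OF tendsto_rabs]) auto
    moreover have "\<forall>\<^sub>F k in sequentially. scale_radius lam (N k) > 0"
      using rad by (simp add: filterlim_at_top_dense)
    ultimately show "\<forall>\<^sub>F k in sequentially. \<bar>Arg (z k)\<bar> \<le> \<theta>"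
      by eventually_elim (simp add: z_def)
    have "filterlim (\<lambda>k. norm (u k) * scale_radius lam (N k)) at_top sequentially"
      by (rule filterlim_tendsto_pos_mult_at_top[OF tendsto_norm[OF u] _ rad]) simp
    moreover have "norm (u k) * scale_radius lam (N k) = norm (z k)" for k
      by (simp add: z_def norm_mult scale_radius_def)
    ultimately show "filterlim (\<lambda>k. norm (z k)) at_top sequentially"
      by simp
  qed
  \<comment> \<open>The scaled quantity \<open>sqrt N * (1 - (norm (u k))\<^sup>2)\<close> tends to
    \<open>- 2 * Re w0 = 4 * d\<close>, so it eventually exceeds \<open>2 * d\<close>; dividing by
    \<open>1 + norm (u k) < 2\<close> leaves at least \<open>d\<close>.\<close>
  define d where "d = - Re w0 / 2"
  have d: "d > 0" using Rew by (simp add: d_def)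
  have gap: "\<forall>\<^sub>F k in sequentially. d \<le> sqrt (N k) * (1 - norm (u k))"
  proof -
    have "(\<lambda>k. - 2 * Re (w k) - (norm (w k))\<^sup>2 * inverse (sqrt (N k))) \<longlonglongrightarrow> - 2 * Re w0 - (norm w0)\<^sup>2 * 0"
      by (intro tendsto_intros w inv)
    then have "\<forall>\<^sub>F k in sequentially. - 2 * Re (w k) - (norm (w k))\<^sup>2 * inverse (sqrt (N k)) > 2 * d"
      by (rule order_tendstoD(1)) (use Rew in \<open>simp add: d_def\<close>)
    then show ?thesis
      using ev[OF eventually_gt_at_top[of 0]]
    proof eventually_elim
      case (elim k)
      define M where "M = sqrt (N k)"
      have M: "M > 0" using elim by (simp add: M_def)
      have "M * (1 - (norm (u k))\<^sup>2) = - 2 * Re (w k) - (norm (w k))\<^sup>2 * inverse M"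
        using M unfolding cmod_power2 u_def x_def M_def[symmetric] by (simp add: field_simps power2_eq_square)
      then have gt: "M * (1 - (norm (u k))\<^sup>2) > 2 * d" using elim by (simp add: M_def)
      then have "0 < M * (1 - (norm (u k))\<^sup>2)" using d by linarith
      then have lt1: "norm (u k) < 1" using M by (simp add: zero_less_mult_iff power_less_one_iff abs_square_less_1)
      have "M * (1 - (norm (u k))\<^sup>2) = M * (1 - norm (u k)) * (1 + norm (u k))"
        by (simp add: power2_eq_square algebra_simps)
      also have "\<dots> \<le> M * (1 - norm (u k)) * 2" using lt1 M by (intro mult_left_mono) auto
      finally show ?case using gt by (simp add: M_def)
    qed
  qed
  obtain D \<kappa> where \<kappa>: "0 < \<kappa>" and "\<forall>\<^sub>F k in sequentially. \<forall>s. norm (kernel (N k) (u k) s) \<le> D * exp (- \<kappa> * s\<^sup>2)"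
    using kernel_dominated[OF N u g q[unfolded z_def] d gap] by blast
  moreover have "\<forall>\<^sub>F k in sequentially. (kernel (N k) (u k) has_integral 2 * of_real pi * (1 - \<rho> k)) UNIV"
  proof -
    have "\<forall>\<^sub>F k in sequentially. norm (rel (z k)) > 0"
      by (intro order_tendstoD(1)[OF tendsto_norm[OF q]]) auto
    then show ?thesis
      using gap ev[OF eventually_gt_at_top[of 0]]
    proof eventually_elim
      case (elim k)
      have "0 < sqrt (N k) * (1 - norm (u k))" using elim d by linarith
      then have "norm (u k) < 1" by (simp add: zero_less_mult_iff)
      moreover have "f (z k) \<noteq> 0" using elim by (auto simp: rel_def)
      ultimately show ?case
        using kernel_has_integral[of "N k" "u k"] elim by (simp add: z_def \<rho>_def)
    qed
  qed
  ultimately have "\<forall>\<^sub>F k in sequentially. (\<forall>s. norm (kernel (N k) (u k) s) \<le> D * exp (- \<kappa> * s\<^sup>2)) \<and>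
      (kernel (N k) (u k) has_integral 2 * of_real pi * (1 - \<rho> k)) UNIV"
    by (intro eventually_conj)
  \<comment> \<open>Dominated convergence asks for integrability and the bound at every index, so
    the sequence is shifted by \<open>K\<close>.\<close>
  then obtain K where K: "\<And>k. k \<ge> K \<Longrightarrow> (\<forall>s. norm (kernel (N k) (u k) s) \<le> D * exp (- \<kappa> * s\<^sup>2)) \<and>
      (kernel (N k) (u k) has_integral 2 * of_real pi * (1 - \<rho> k)) UNIV"
    by (auto simp: eventually_sequentially)
  have "(\<lambda>k. integral UNIV (kernel (N (k + K)) (u (k + K)))) \<longlonglongrightarrow>
     integral UNIV (\<lambda>s. exp (- (of_real (s\<^sup>2) / 2) - v\<^sup>2 / 2) / (\<i> * of_real s - v))"
  proof (rule dominated_convergence(2))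
    show "(\<lambda>s. D * exp (- \<kappa> * s\<^sup>2)) integrable_on UNIV"
      by (intro integrable_on_mult_right integrable_on_gaussian \<kappa>)
    show "kernel (N (k + K)) (u (k + K)) integrable_on UNIV" for k
      using K[of "k + K"] by auto
    show "norm (kernel (N (k + K)) (u (k + K)) s) \<le> D * exp (- \<kappa> * s\<^sup>2)" for k s
      using K[of "k + K"] by auto
    show "(\<lambda>k. kernel (N (k + K)) (u (k + K)) s) \<longlonglongrightarrow> exp (- (of_real (s\<^sup>2) / 2) - v\<^sup>2 / 2) / (\<i> * of_real s - v)" for s
      unfolding v_def
      by (rule LIMSEQ_ignore_initial_segment[OF kernel_tendsto[OF N u _ Rew g q[unfolded z_def]]])
         (use xw in \<open>simp add: u_def\<close>)
  qed
  moreover have "integral UNIV (kernel (N (k + K)) (u (k + K))) = 2 * of_real pi * (1 - \<rho> (k + K))" for k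
    using K[of "k + K"] by (auto intro: integral_unique)
  moreover have "integral UNIV (\<lambda>s. exp (- (of_real (s\<^sup>2) / 2) - v\<^sup>2 / 2) / (\<i> * of_real s - v)) = of_real pi * erfc (- v / of_real (sqrt 2))"
    by (intro integral_unique gaussian_cauchy_transform) (use Rew lam in \<open>simp add: v_def mult_pos_neg\<close>)
  ultimately have "(\<lambda>k. 2 * of_real pi * (1 - \<rho> (k + K))) \<longlonglongrightarrow> of_real pi * erfc (- v / of_real (sqrt 2))"
    by simp
  then have "(\<lambda>k. 2 * of_real pi * (1 - \<rho> k)) \<longlonglongrightarrow> of_real pi * erfc (- v / of_real (sqrt 2))"
    by (rule LIMSEQ_offset)
  from tendsto_diff[OF tendsto_const[of 1] tendsto_divide[OF this tendsto_const[of "2 * of_real pi"]]]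
  have "(\<lambda>k. 1 - 2 * of_real pi * (1 - \<rho> k) / (2 * of_real pi)) \<longlonglongrightarrow> 1 - of_real pi * erfc (- v / of_real (sqrt 2)) / (2 * of_real pi)"
    by simp
  moreover have "v / of_real (sqrt 2) = w0 * of_real (sqrt (lam / 2))"
    by (simp add: v_def real_sqrt_divide)
  then have "1 - of_real pi * erfc (- v / of_real (sqrt 2)) / (2 * of_real pi) = erfc (w0 * of_real (sqrt (lam / 2))) / 2"
    by (simp add: erfc_reflect diff_divide_distrib)
  moreover have "1 - 2 * of_real pi * (1 - \<rho> k) / (2 * of_real pi) = \<rho> k" for k
    by simp
  ultimately have "\<rho> \<longlonglongrightarrow> erfc (w0 * of_real (sqrt (lam / 2))) / 2"
    by (simp only:)
  then show ?thesis
    by (simp only: \<rho>_def z_def u_def x_def)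
qed

end

subsection \<open>Uniformity on compact sets\<close>

text \<open>The hypothesis is continuous convergence. It first forces \<open>G\<close> to be
  sequentially continuous on \<open>K\<close>. If uniformity failed, compactness would give a
  convergent subsequence of bad points, along which \<open>F\<close> and \<open>G\<close> have the
  same limit, contradicting the distance \<open>\<epsilon>\<close>.\<close>

lemma uniform_limit_if_sequences:
  fixes F :: "nat \<Rightarrow> 'a::metric_space \<Rightarrow> 'b::real_normed_vector"
  assumes K: "compact K"
    and seq: "\<And>N w w0. filterlim N at_top sequentially \<Longrightarrow> (\<And>k. w k \<in> K) \<Longrightarrow> w0 \<in> K \<Longrightarrow> w \<longlonglongrightarrow> w0 \<Longrightarrow>
       (\<lambda>k. F (N k) (w k)) \<longlonglongrightarrow> G w0"
  shows "uniform_limit K F G sequentially"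
proof (rule ccontr)
  have G: "(\<lambda>k. G (w k)) \<longlonglongrightarrow> G w0" if w: "\<And>k. w k \<in> K" "w0 \<in> K" "w \<longlonglongrightarrow> w0" for w w0
  proof -
    \<comment> \<open>Pointwise convergence at the fixed point \<open>w k\<close> comes from
      constant sequences; an index beyond \<open>k\<close> is chosen where the error is below
      \<open>1 / (k + 1)\<close>.\<close>
    have "\<exists>n \<ge> k. dist (F n (w k)) (G (w k)) < inverse (real (Suc k))" for k
    proof -
      have "(\<lambda>n. F n (w k)) \<longlonglongrightarrow> G (w k)"
        using seq[of "\<lambda>n. n" "\<lambda>_. w k" "w k"] w by (simp add: filterlim_ident)
      then have "\<forall>\<^sub>F n in sequentially. dist (F n (w k)) (G (w k)) < inverse (real (Suc k))"
        by (rule tendstoD) simp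
      then show ?thesis
        using eventually_happens'[OF sequentially_bot eventually_conj[OF _ eventually_ge_at_top[of k]]] by blast
    qed
    then obtain N where N: "\<And>k. k \<le> N k" "\<And>k. dist (F (N k) (w k)) (G (w k)) < inverse (real (Suc k))"
      by metis
    have "filterlim N at_top sequentially"
      by (rule filterlim_at_top_mono[OF filterlim_ident]) (simp add: N)
    then have lim: "(\<lambda>k. F (N k) (w k)) \<longlonglongrightarrow> G w0" by (rule seq) (use w in auto)
    have "(\<lambda>k. dist (F (N k) (w k)) (G (w k))) \<longlonglongrightarrow> 0"
      by (rule tendsto_sandwich[OF _ _ tendsto_const LIMSEQ_inverse_real_of_nat])
         (use N(2) in \<open>auto intro: always_eventually less_imp_le\<close>)
    then have "(\<lambda>k. F (N k) (w k) - G (w k)) \<longlonglongrightarrow> 0"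
      by (simp add: dist_norm tendsto_norm_zero_iff)
    with lim show ?thesis by (rule Lim_transform2)
  qed
  assume "\<not> uniform_limit K F G sequentially"
  then obtain \<epsilon> where \<epsilon>: "\<epsilon> > 0" and "\<And>n0. \<exists>n \<ge> n0. \<exists>x \<in> K. \<epsilon> \<le> dist (F n x) (G x)"
    unfolding uniform_limit_sequentially_iff by (meson not_le)
  then obtain N w where N: "\<And>n. n \<le> N n" and w: "\<And>n. w n \<in> K" and far: "\<And>n. \<epsilon> \<le> dist (F (N n) (w n)) (G (w n))"
    by metis
  obtain w0 \<sigma> where \<sigma>: "w0 \<in> K" "strict_mono \<sigma>" "(w \<circ> \<sigma>) \<longlonglongrightarrow> w0"
    using K w unfolding compact_def by metis
  have "filterlim (\<lambda>k. N (\<sigma> k)) at_top sequentially"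
    by (rule filterlim_at_top_mono[OF filterlim_subseq[OF \<sigma>(2)]]) (simp add: N)
  then have 1: "(\<lambda>k. F (N (\<sigma> k)) (w (\<sigma> k))) \<longlonglongrightarrow> G w0"
    by (rule seq) (use \<sigma> w in \<open>auto simp: o_def\<close>)
  have 2: "(\<lambda>k. G (w (\<sigma> k))) \<longlonglongrightarrow> G w0"
    using \<sigma> w by (intro G) (auto simp: o_def)
  have "(\<lambda>k. dist (F (N (\<sigma> k)) (w (\<sigma> k))) (G (w (\<sigma> k)))) \<longlonglongrightarrow> 0"
    using tendsto_dist[OF 1 2] by simp
  then have "\<forall>\<^sub>F k in sequentially. dist (F (N (\<sigma> k)) (w (\<sigma> k))) (G (w (\<sigma> k))) < \<epsilon>"
    using \<epsilon> by (rule order_tendstoD)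
  then obtain k where "dist (F (N (\<sigma> k)) (w (\<sigma> k))) (G (w (\<sigma> k))) < \<epsilon>"
    by (auto simp: eventually_sequentially)
  then show False using far[of "\<sigma> k"] by simp
qed

context sector_asymptotics
begin

lemma partial_sum_ratio_uniform_limit:
  assumes "compact K" "K \<subseteq> {w. Re w < 0}"
  shows "uniform_limit K
      (\<lambda>n w. taylor_partial_sum f (n - 1) (of_real (scale_radius lam n) * (1 + w / of_real (sqrt n)))
        / f (of_real (scale_radius lam n) * (1 + w / of_real (sqrt n))))
      (\<lambda>w. erfc (w * of_real (sqrt (lam / 2))) / 2) sequentially"
  by (rule uniform_limit_if_sequences[OF assms(1)], rule partial_sum_ratio_tendsto) (use assms(2) in auto)

end

theorem theorem1p1:
  fixes a b \<sigma>1 \<sigma>2 :: complex and lam \<theta> \<mu> :: real and f :: "complex \<Rightarrow> complex"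
  assumes lam: "0 < lam"
    and theta: "0 < \<theta>" "\<theta> < min pi (pi / lam)"
    and mu: "\<mu> < 1"
    and entire: "f holomorphic_on UNIV"
    and order: "entire_order f = ereal lam"
    and inside_sector:
      "f \<sim>[inf at_infinity (principal {z. \<bar>Arg z\<bar> \<le> \<theta>})]
         (\<lambda>z. z powr a * Ln z powr b * exp (z powr complex_of_real lam))"
    and outside_sector:
      "(\<lambda>z. norm (f z)) \<in> O[inf at_infinity (principal {z. \<bar>Arg z\<bar> > \<theta>})](\<lambda>z. exp (\<mu> * norm z powr lam))"
    and sigma: "sphere 1 (sin (\<theta> / 2)) \<inter> steepest_descent_path lam = {\<sigma>1, \<sigma>2}" "\<sigma>1 \<noteq> \<sigma>2"
    and log_deriv:
      "\<exists>\<nu>. 0 < \<nu> \<and> \<nu> < - Re (phi lam \<sigma>1) \<and>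
         (\<forall>K. compact K \<and> K \<subseteq> {z. z \<noteq> 0 \<and> \<bar>Arg z\<bar> \<le> \<theta>} \<longrightarrow>
           (\<exists>C. \<forall>\<^sub>F n in sequentially. \<forall>z\<in>K.
             norm (deriv f (complex_of_real (scale_radius lam n) * z) /
                   f (complex_of_real (scale_radius lam n) * z)) \<le> C * exp (\<nu> * real n)))"
  shows "\<forall>K. compact K \<and> K \<subseteq> {w. Re w < 0} \<longrightarrow>
    uniform_limit K
      (\<lambda>n w. taylor_partial_sum f (n - 1)
               (complex_of_real (scale_radius lam n) * (1 + w / complex_of_real (sqrt (real n)))) /
             f (complex_of_real (scale_radius lam n) * (1 + w / complex_of_real (sqrt (real n)))))
      (\<lambda>w. erfc (w * complex_of_real (sqrt (lam / 2))) / 2)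
      sequentially"
proof (intro allI impI)
  fix K :: "complex set"
  assume K: "compact K \<and> K \<subseteq> {w. Re w < 0}"
  \<comment> \<open>The asymptotic hypothesis on the inner sector is that of the locale with
    \<open>growth\<close> unfolded.\<close>
  interpret sector_asymptotics a b lam \<theta> \<mu> f
    by unfold_locales
       (use lam theta mu entire inside_sector outside_sector in \<open>simp_all add: growth_def[abs_def]\<close>)
  show "uniform_limit K
      (\<lambda>n w. taylor_partial_sum f (n - 1)
               (complex_of_real (scale_radius lam n) * (1 + w / complex_of_real (sqrt (real n)))) /
             f (complex_of_real (scale_radius lam n) * (1 + w / complex_of_real (sqrt (real n)))))
      (\<lambda>w. erfc (w * complex_of_real (sqrt (lam / 2))) / 2)
      sequentially"
    using K by (intro partial_sum_ratio_uniform_limit) auto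
qed

end
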